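(* Let $Z>1$, $A=Z-1/Z$, and let $$q(x)=1-\frac{iA}{\cosh(Ax)},\qquad x\in\mathbb{R}.$$ Let $c\in i\mathbb{R}^+\cup\mathbb{R}^+$, write $c=ig$, let $k\in\mathbb{R}$ be such that $k^2+g^2>0$, and let $\mu=\mu(k)=\sqrt{k^2+g^2}$. Then the finite-density scattering coefficients of $q$ with coupling $c$ are $$a(\mu,c)=\frac{\Gamma\left(\frac12-\frac{i\mu}{A}\right)^2}{\Gamma\left(\frac12-g-\frac{i\mu}{A}\right)\Gamma\left(\frac12+g-\frac{i\mu}{A}\right)},\qquad b(\mu,c)=-\frac{\sin(\pi g)}{g}\,\frac{1}{\cosh\frac{\pi\mu}{A}},$$ where $\Gamma$ is the Gamma function. In particular, for $c=i$ (i.e. $g=1$), one has $b(\mu,i)=0$ and $a(\mu,i)=\frac{\mu-\mu_1}{\mu-\mu_1^*}$ with $\mu_1=\frac{iA}{2}$.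
   Context: The (gauged) nonlinear Schrödinger equation with finite density $\rho=1$ is $i\partial_tq+\partial_x^2q-2c^2(|q|^2-1)q=0$; $c\in i\mathbb{R}^+$ is the focusing (attractive) case and $c>0$ the defocusing case. The given $q$, which tends to $1$ as $x\to\pm\infty$, is the initial profile of a stationary one-soliton solution on a constant background for $c=i$ (up to a translation in $x$). Set $W(x)=c\begin{pmatrix}0&q(x)\\ q^*(x)&0\end{pmatrix}$ and $\sigma_3=\mathrm{diag}(1,-1)$; then $W(x)\to c\begin{pmatrix}0&1\\1&0\end{pmatrix}$ as $x\to\pm\infty$. With $c=ig$ and $\mu=\sqrt{k^2+g^2}$, let $$P=\begin{pmatrix}1&\frac{\mu-k}{g}\\ -\frac{\mu-k}{g}&1\end{pmatrix},\qquad E(x,k)=P\,e^{-i\mu x\sigma_3},$$ so that $E$ solves $E_x=\left(-ik\sigma_3+c\begin{pmatrix}0&1\\1&0\end{pmatrix}\right)E$. The Jost solution $\Psi^+(x,k)$ is the unique $2\times 2$ matrix solution of $\Psi_x=(-ik\sigma_3+W(x))\Psi$ with $\lim_{x\to+\infty}E^{-1}(x,k)\Psi^+(x,k)=\mathbf{1}_2$. The scattering matrix is $S=\lim_{x\to-\infty}E^{-1}(x,k)\Psi^+(x,k)$, and the scattering coefficients are $b(\mu,c)=S_{12}$ and $a(\mu,c)=S_{22}$.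
   Formalization: The printed formula for b is false for b = S₁₂ (e.g. g = 1/2 and small μ/A would give |b| > 1, against |a|²+|b|² = 1); the theorem proves b = −sin(πg)/cosh(πμ/A), without the factor 1/g, and agrees with the printed b at g = 1. *)

theory Defs
  imports "HOL-Analysis.Analysis"
begin

definition mat2 :: "complex \<Rightarrow> complex \<Rightarrow> complex \<Rightarrow> complex \<Rightarrow> complex^2^2" where
  "mat2 m11 m12 m21 m22 = vector [vector [m11, m12], vector [m21, m22]]"

definition sigma3 :: "complex^2^2" where
  "sigma3 = mat2 1 0 0 (-1)"

(* The parameter g with c = i g. *)
definition g_of :: "complex \<Rightarrow> complex" where
  "g_of c = c / \<i>"

(* For c real or purely imaginary g^2 is real, so taking the real part loses nothing. *)
definition mu_of :: "complex \<Rightarrow> real \<Rightarrow> real" where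
  "mu_of c k = sqrt (k^2 + Re ((g_of c)^2))"

definition W_potential :: "(real \<Rightarrow> complex) \<Rightarrow> complex \<Rightarrow> real \<Rightarrow> complex^2^2" where
  "W_potential q c x = mat2 0 (c * q x) (c * cnj (q x)) 0"

(* The scalar multiple z M of a complex matrix M is written mat z ** M. *)
definition lax_matrix :: "(real \<Rightarrow> complex) \<Rightarrow> complex \<Rightarrow> real \<Rightarrow> real \<Rightarrow> complex^2^2" where
  "lax_matrix q c k x = mat (- \<i> * of_real k) ** sigma3 + W_potential q c x"

definition P_matrix :: "complex \<Rightarrow> real \<Rightarrow> complex^2^2" where
  "P_matrix c k =
     mat2 1 ((of_real (mu_of c k) - of_real k) / g_of c)
          (- ((of_real (mu_of c k) - of_real k) / g_of c)) 1"

(* E(x,k) = P exp(-i mu x sigma3); the exponential of the diagonal matrix is taken entrywise. *)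
definition E_matrix :: "complex \<Rightarrow> real \<Rightarrow> real \<Rightarrow> complex^2^2" where
  "E_matrix c k x =
     P_matrix c k ** mat2 (exp (- \<i> * of_real (mu_of c k * x))) 0
                          0 (exp (\<i> * of_real (mu_of c k * x)))"

definition is_jost_solution ::
    "(real \<Rightarrow> complex) \<Rightarrow> complex \<Rightarrow> real \<Rightarrow> (real \<Rightarrow> complex^2^2) \<Rightarrow> bool" where
  "is_jost_solution q c k \<Psi> \<longleftrightarrow>
     (\<forall>x. (\<Psi> has_vector_derivative (lax_matrix q c k x ** \<Psi> x)) (at x)) \<and>
     ((\<lambda>x. matrix_inv (E_matrix c k x) ** \<Psi> x) \<longlongrightarrow> mat 1) at_top"

definition jost_solution ::
    "(real \<Rightarrow> complex) \<Rightarrow> complex \<Rightarrow> real \<Rightarrow> real \<Rightarrow> complex^2^2" where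
  "jost_solution q c k = (THE \<Psi>. is_jost_solution q c k \<Psi>)"

definition scattering_matrix ::
    "(real \<Rightarrow> complex) \<Rightarrow> complex \<Rightarrow> real \<Rightarrow> complex^2^2" where
  "scattering_matrix q c k =
     Lim at_bot (\<lambda>x. matrix_inv (E_matrix c k x) ** jost_solution q c k x)"

definition scattering_a :: "(real \<Rightarrow> complex) \<Rightarrow> complex \<Rightarrow> real \<Rightarrow> complex" where
  "scattering_a q c k = scattering_matrix q c k $ 2 $ 2"

(* Pitfall: in this normalisation |a|^2 + |b|^2 = 1 for real g (and |a|^2 - |b|^2 = 1 for
   imaginary g).  Formulas for b with an additional factor 1/g belong to the normalisation
   S_12 = g b, in which |a|^2 + g^2 |b|^2 = 1 instead. *)
definition scattering_b :: "(real \<Rightarrow> complex) \<Rightarrow> complex \<Rightarrow> real \<Rightarrow> complex" where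
  "scattering_b q c k = scattering_matrix q c k $ 1 $ 2"

end

(*
  The matrix P commutes with [[0,1],[-1,0]], the direction of the x-dependent part of the Lax
  matrix, and diagonalises its constant part. Hence N = E^{-1} Psi solves a Zakharov-Shabat
  system in the interaction picture with the potential g A / cosh (A x). In the variable
  t = (1 - tanh (A x)) / 2 its solutions are hypergeometric functions with parameters g, -g and
  1/2 - i mu / A. As x tends to minus infinity, t tends to 1: a is the value at 1 given by
  Gauss's summation theorem, and b is the coefficient of the leading singularity at t = 1 of the
  derivative. Uniqueness follows from the constancy of Wronskians.
*)

theory Submission
  imports Defs
begin

section \<open>The hypergeometric function at 1\<close>

text \<open>The two endpoint results differ because of the exponent c - a - b. With gamma = 1/2 - i
  mu / A it equals gamma for the function itself, so the series converges absolutely at 1. For the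
  derivative all three parameters rise by one and the exponent drops to gamma - 1, with real part
  -1/2, so the series may grow like (1 - t) to the power gamma - 1. The prefactor of the other
  component decays at exactly the inverse rate, which leaves a finite limit. Both results rest on
  one fact, the limit of quotients of Pochhammer symbols with balanced parameters. The definitions
  use \<open>THE\<close> and \<open>Lim\<close>, so existence, uniqueness and convergence of all
  four entries have to be established, although a and b live in the second column. The first column
  comes from the same explicit solution with mu replaced by - mu, and not from complex conjugation;
  real g (focusing) and imaginary g (defocusing) are thereby treated alike.\<close>

definition hyp_coeff :: "complex \<Rightarrow> complex \<Rightarrow> complex \<Rightarrow> nat \<Rightarrow> complex" where
  "hyp_coeff a b c n = pochhammer a n * pochhammer b n / (pochhammer c n * fact n)"

text \<open>The plain series suffices: its argument \<open>zs_t A x\<close> stays strictly between 0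
  and 1, and at \<open>z = 1\<close> the series converges absolutely if Re (c - a - b) > 0.\<close>

definition hyp2F1 :: "complex \<Rightarrow> complex \<Rightarrow> complex \<Rightarrow> complex \<Rightarrow> complex" where
  "hyp2F1 a b c z = (\<Sum>n. hyp_coeff a b c n * z ^ n)"

lemma plus_of_nat_nonzero:
  assumes "(c::complex) \<notin> \<int>\<^sub>\<le>\<^sub>0"
  shows "c + of_nat n \<noteq> 0"
  using assms by (metis add_eq_0_iff2 nonpos_Ints_of_int minus_of_nat_in_nonpos_Ints)

lemma pochhammer_nonzero:
  assumes "(c::complex) \<notin> \<int>\<^sub>\<le>\<^sub>0"
  shows "pochhammer c n \<noteq> 0"
  using assms by (metis pochhammer_eq_0_iff minus_of_nat_in_nonpos_Ints)

lemma not_nonpos_Ints_Re_pos: "Re c > 0 \<Longrightarrow> c \<notin> \<int>\<^sub>\<le>\<^sub>0"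
  by (auto elim!: nonpos_Ints_cases)

lemma hyp_coeff_0 [simp]: "hyp_coeff a b c 0 = 1"
  by (simp add: hyp_coeff_def)

lemma hyp_coeff_Suc:
  assumes "c \<notin> \<int>\<^sub>\<le>\<^sub>0"
  shows "hyp_coeff a b c (Suc n) =
           (a + of_nat n) * (b + of_nat n) / ((c + of_nat n) * of_nat (Suc n)) * hyp_coeff a b c n"
  by (simp add: hyp_coeff_def pochhammer_Suc field_simps)

text \<open>This division-free form is the hypergeometric equation read off coefficient by
  coefficient.\<close>

lemma hyp_coeff_recurrence:
  assumes "c \<notin> \<int>\<^sub>\<le>\<^sub>0"
  shows "(c + of_nat n) * (of_nat (Suc n) * hyp_coeff a b c (Suc n)) =
           (a + of_nat n) * (b + of_nat n) * hyp_coeff a b c n"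
proof -
  have "c + of_nat n \<noteq> 0" "(of_nat (Suc n) :: complex) \<noteq> 0"
    using plus_of_nat_nonzero[OF assms] by (simp_all del: of_nat_Suc)
  then show ?thesis
    unfolding hyp_coeff_Suc[OF assms] by (simp add: divide_simps del: of_nat_Suc)
qed

text \<open>Splitting the first factor off each of the Pochhammer symbols shows that differentiation
  raises all three parameters by one.\<close>

lemma diffs_hyp_coeff:
  "diffs (hyp_coeff a b c) n = a * b / c * hyp_coeff (a + 1) (b + 1) (c + 1) n"
  by (simp add: diffs_def hyp_coeff_def pochhammer_rec field_simps del: of_nat_Suc)

lemma summable_hyp_coeff:
  assumes c: "c \<notin> \<int>\<^sub>\<le>\<^sub>0" and z: "norm z < 1"
  shows "summable (\<lambda>n. hyp_coeff a b c n * z ^ n)"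
proof -
  define q where "q n = (a + of_nat n) * (b + of_nat n) / ((c + of_nat n) * of_nat (Suc n))" for n
  have inv: "(\<lambda>n. w / of_nat n) \<longlonglongrightarrow> 0" for w :: complex
    using tendsto_mult[OF tendsto_const lim_1_over_n, of w] by simp
  have one: "(\<lambda>n. (w + of_nat n) / of_nat n) \<longlonglongrightarrow> 1" for w :: complex
  proof (rule Lim_transform_eventually)
    show "(\<lambda>n. w / of_nat n + 1) \<longlonglongrightarrow> 1"
      using tendsto_add[OF inv[of w] tendsto_const[of 1]] by simp
    show "\<forall>\<^sub>F n in sequentially. w / of_nat n + 1 = (w + of_nat n) / of_nat n"
      using eventually_gt_at_top[of 0] by eventually_elim (simp add: field_simps)
  qed
  \<comment> \<open>Numerator and denominator of \<open>q n\<close> are divided by n^2, as each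
    linear factor over n tends to 1.\<close>
  have "(\<lambda>n. ((a + of_nat n) / of_nat n * ((b + of_nat n) / of_nat n)) /
          ((c + of_nat n) / of_nat n * ((1 + of_nat n) / of_nat n))) \<longlonglongrightarrow> 1 * 1 / (1 * 1)"
    by (intro tendsto_intros one) auto
  then have "(\<lambda>n. ((a + of_nat n) / of_nat n * ((b + of_nat n) / of_nat n)) /
          ((c + of_nat n) / of_nat n * ((1 + of_nat n) / of_nat n))) \<longlonglongrightarrow> 1"
    by simp
  then have "q \<longlonglongrightarrow> 1"
    by (rule Lim_transform_eventually)
      (use eventually_gt_at_top[of 0] in eventually_elim, simp add: q_def)
  then have "(\<lambda>n. norm (q n * z)) \<longlonglongrightarrow> norm (1 * z)"
    by (intro tendsto_intros)
  \<comment> \<open>The bound for the ratio test is the midpoint between the limit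
    \<open>norm z\<close> and 1.\<close>
  then have "\<forall>\<^sub>F n in sequentially. norm (q n * z) < (1 + norm z) / 2"
    by (rule order_tendstoD) (use z in simp)
  then obtain N where N: "\<And>n. n \<ge> N \<Longrightarrow> norm (q n * z) < (1 + norm z) / 2"
    by (auto simp: eventually_sequentially)
  show ?thesis
  proof (rule summable_ratio_test[where c = "(1 + norm z) / 2" and N = N])
    show "(1 + norm z) / 2 < 1" using z by simp
    fix n assume "n \<ge> N"
    have "norm (hyp_coeff a b c (Suc n) * z ^ Suc n)
        = norm (q n * z) * norm (hyp_coeff a b c n * z ^ n)"
      unfolding hyp_coeff_Suc[OF c] q_def[symmetric] by (simp add: norm_mult norm_power)
    also have "\<dots> \<le> (1 + norm z) / 2 * norm (hyp_coeff a b c n * z ^ n)"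
      using N[OF \<open>n \<ge> N\<close>] by (intro mult_right_mono) auto
    finally show "norm (hyp_coeff a b c (Suc n) * z ^ Suc n)
        \<le> (1 + norm z) / 2 * norm (hyp_coeff a b c n * z ^ n)" .
  qed
qed

lemma hyp2F1_has_field_derivative:
  assumes "c \<notin> \<int>\<^sub>\<le>\<^sub>0" "norm z < 1"
  shows "(hyp2F1 a b c has_field_derivative a * b / c * hyp2F1 (a + 1) (b + 1) (c + 1) z) (at z)"
proof -
  have c1: "c + 1 \<notin> \<int>\<^sub>\<le>\<^sub>0"
    using assms(1) plus_one_in_nonpos_Ints_imp by blast
  have "(\<Sum>n. diffs (hyp_coeff a b c) n * z ^ n) = a * b / c * hyp2F1 (a + 1) (b + 1) (c + 1) z"
    using suminf_mult[OF summable_hyp_coeff[OF c1 assms(2)], of "a * b / c"]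
    by (simp add: hyp2F1_def diffs_hyp_coeff mult.assoc)
  moreover have "hyp2F1 a b c = (\<lambda>z. \<Sum>n. hyp_coeff a b c n * z ^ n)"
    by (simp add: hyp2F1_def fun_eq_iff)
  ultimately show ?thesis
    using termdiffs_strong'[of 1 "hyp_coeff a b c" z] summable_hyp_coeff[OF assms(1)] assms(2)
    by simp
qed

text \<open>\<open>F1\<close> and \<open>F2\<close> are the first and second derivatives in the
  closed form supplied by \<open>hyp2F1_has_field_derivative\<close>. All terms are brought to the
  same power of z, where \<open>hyp_coeff_recurrence\<close> makes each coefficient vanish.\<close>

lemma hyp2F1_ode:
  assumes c: "c \<notin> \<int>\<^sub>\<le>\<^sub>0" and z: "norm z < 1"
    and F1: "F1 = a * b / c * hyp2F1 (a + 1) (b + 1) (c + 1) z"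
    and F2: "F2 = a * b / c * ((a + 1) * (b + 1) / (c + 1) * hyp2F1 (a + 2) (b + 2) (c + 2) z)"
  shows "z * (1 - z) * F2 + (c - (a + b + 1) * z) * F1 - a * b * hyp2F1 a b c z = 0"
proof -
  define u where "u = hyp_coeff a b c"
  have c1: "c + 1 \<notin> \<int>\<^sub>\<le>\<^sub>0" and c2: "c + 2 \<notin> \<int>\<^sub>\<le>\<^sub>0"
    using c plus_one_in_nonpos_Ints_imp[of c] plus_one_in_nonpos_Ints_imp[of "c + 1"] 
    by (auto simp: add.assoc)
  have s0: "(\<lambda>n. u n * z ^ n) sums hyp2F1 a b c z"
    unfolding u_def hyp2F1_def by (intro summable_sums summable_hyp_coeff c z)
  have d1: "diffs u n = a * b / c * hyp_coeff (a + 1) (b + 1) (c + 1) n" for n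
    by (simp add: u_def diffs_hyp_coeff)
  have d1': "diffs u = (\<lambda>n. a * b / c * hyp_coeff (a + 1) (b + 1) (c + 1) n)"
    using d1 by auto
  have scale: "diffs (\<lambda>n. w * v n) n = w * diffs v n" for w and v :: "nat \<Rightarrow> complex" and n
    by (simp add: diffs_def)
  have d2: "diffs (diffs u) n
      = a * b / c * ((a + 1) * (b + 1) / (c + 1) * hyp_coeff (a + 2) (b + 2) (c + 2) n)" for n
    unfolding d1' scale diffs_hyp_coeff by (simp add: add.assoc)
  have s1: "(\<lambda>n. diffs u n * z ^ n) sums F1"
    unfolding d1 F1 hyp2F1_def mult.assoc
    by (intro sums_mult summable_sums summable_hyp_coeff c1 z)
  have s2: "(\<lambda>n. diffs (diffs u) n * z ^ n) sums F2"
    unfolding d2 F2 hyp2F1_def mult.assoc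
    by (intro sums_mult summable_sums summable_hyp_coeff c2 z)
  \<comment> \<open>The Euler operator z d/dz multiplies the n-th coefficient by n.\<close>
  have shift: "(\<lambda>n. of_nat n * v n * z ^ n) sums (z * V)"
    if "(\<lambda>n. diffs v n * z ^ n) sums V" for v V
  proof -
    have "(\<lambda>n. of_nat n * v n * z ^ (n - Suc 0)) sums V"
      using diffs_equiv[OF sums_summable[OF that]] sums_unique[OF that] by simp
    from sums_mult[OF this, of z] show ?thesis
    proof (rule sums_cong[THEN iffD1, rotated])
      show "z * (of_nat n * v n * z ^ (n - Suc 0)) = of_nat n * v n * z ^ n" for n
        by (cases n) auto
    qed
  qed
  have zF1: "(\<lambda>n. of_nat n * u n * z ^ n) sums (z * F1)"
    by (rule shift[OF s1])
  have zF2: "(\<lambda>n. of_nat n * diffs u n * z ^ n) sums (z * F2)"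
    by (rule shift[OF s2])
  \<comment> \<open>n u_n - u_n are the coefficients of z F' - F, whose derivative is z F''; a
    second use of \<open>shift\<close> then yields z^2 F''.\<close>
  have "(\<lambda>n. diffs (\<lambda>n. of_nat n * u n - u n) n * z ^ n) sums (z * F2)"
    using zF2 by (simp add: diffs_def algebra_simps)
  from shift[OF this]
  have zzF2: "(\<lambda>n. of_nat n * (of_nat n * u n - u n) * z ^ n) sums (z * (z * F2))" .
  have "(\<lambda>n. of_nat n * diffs u n * z ^ n - of_nat n * (of_nat n * u n - u n) * z ^ n
          + c * (diffs u n * z ^ n) - (a + b + 1) * (of_nat n * u n * z ^ n) - a * b * (u n * z ^ n))
        sums (z * F2 - z * (z * F2) + c * F1 - (a + b + 1) * (z * F1) - a * b * hyp2F1 a b c z)"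
    by (intro sums_diff sums_add sums_mult zF2 zzF2 s1 zF1 s0)
  moreover have "of_nat n * diffs u n * z ^ n - of_nat n * (of_nat n * u n - u n) * z ^ n
          + c * (diffs u n * z ^ n) - (a + b + 1) * (of_nat n * u n * z ^ n) - a * b * (u n * z ^ n)
        = 0" for n
  proof -
    have "(c + of_nat n) * diffs u n - (a + of_nat n) * (b + of_nat n) * u n = 0"
      using hyp_coeff_recurrence[OF c, of n a b] by (simp add: diffs_def u_def)
    then have "((c + of_nat n) * diffs u n - (a + of_nat n) * (b + of_nat n) * u n) * z ^ n = 0"
      by simp
    then show ?thesis by (simp add: algebra_simps)
  qed
  ultimately have "(\<lambda>n. 0) sums
      (z * F2 - z * (z * F2) + c * F1 - (a + b + 1) * (z * F1) - a * b * hyp2F1 a b c z)"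
    by simp
  then have "z * F2 - z * (z * F2) + c * F1 - (a + b + 1) * (z * F1) - a * b * hyp2F1 a b c z = 0"
    using sums_unique2 sums_zero by blast
  then show ?thesis by (simp add: algebra_simps)
qed

section \<open>Growth of the coefficients from limits defining the Gamma function\<close>

text \<open>In the quotient of four \<open>rGamma_series\<close> the factorials cancel, and the
  balance a + b = c + d cancels the powers of n as well.\<close>

lemma pochhammer_ratio_LIMSEQ:
  fixes a b c d :: complex
  assumes cd: "c \<notin> \<int>\<^sub>\<le>\<^sub>0" "d \<notin> \<int>\<^sub>\<le>\<^sub>0" and eq: "a + b = c + d"
  shows "(\<lambda>n. pochhammer a n * pochhammer b n / (pochhammer c n * pochhammer d n))
           \<longlonglongrightarrow> Gamma c * Gamma d * rGamma a * rGamma b"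
\<comment> \<open>\<open>rGamma_series\<close> at n contains the Pochhammer symbol at
  \<open>Suc n\<close>, hence the shift of the index.\<close>
proof (rule LIMSEQ_imp_Suc)
  have "(\<lambda>n. rGamma_series a n * rGamma_series b n / (rGamma_series c n * rGamma_series d n))
      \<longlonglongrightarrow> rGamma a * rGamma b / (rGamma c * rGamma d)"
    using cd by (intro tendsto_intros) (auto simp: rGamma_eq_zero_iff)
  moreover have "rGamma_series a n * rGamma_series b n / (rGamma_series c n * rGamma_series d n)
      = pochhammer a (Suc n) * pochhammer b (Suc n) / (pochhammer c (Suc n) * pochhammer d (Suc n))"
    for n
  proof -
    define L :: complex where "L = of_real (ln (of_nat n))"
    have "exp (a * L) * exp (b * L) = exp (c * L) * exp (d * L)"
      using eq by (metis exp_add distrib_right)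
    then show ?thesis
      unfolding rGamma_series_def L_def[symmetric] by (simp add: field_simps)
  qed
  ultimately show "(\<lambda>n. pochhammer a (Suc n) * pochhammer b (Suc n) /
      (pochhammer c (Suc n) * pochhammer d (Suc n))) \<longlonglongrightarrow> Gamma c * Gamma d * rGamma a * rGamma b"
    by (simp add: rGamma_inverse_Gamma divide_simps mult_ac)
qed

text \<open>Without the balance of parameters a power of n with exponent a + b - c - 1 survives,
  times a convergent and hence bounded quotient. The case n = 0 is excluded because
  \<open>0 powr\<close> anything is 0.\<close>

lemma norm_hyp_coeff_bound:
  assumes c: "c \<notin> \<int>\<^sub>\<le>\<^sub>0"
  obtains M where "M \<ge> 0"
    "\<And>n. n > 0 \<Longrightarrow> norm (hyp_coeff a b c (Suc n)) \<le> M * real n powr (Re (a + b - c) - 1)"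
proof -
  \<comment> \<open>The parameter 1 stands for the factorial, as
    \<open>pochhammer 1 n = fact n\<close>.\<close>
  define r where "r n = rGamma_series a n * rGamma_series b n / (rGamma_series c n * rGamma_series 1 n)" for n
  have "r \<longlonglongrightarrow> rGamma a * rGamma b / (rGamma c * rGamma 1)"
    unfolding r_def using c by (intro tendsto_intros) (auto simp: rGamma_eq_zero_iff)
  then have "Bseq r"
    by (intro convergent_imp_Bseq convergentI)
  then obtain M where M: "M > 0" "\<And>n. norm (r n) \<le> M"
    by (auto simp: Bseq_def)
  have "norm (hyp_coeff a b c (Suc n)) \<le> M * real n powr (Re (a + b - c) - 1)" if "n > 0" for n
  proof -
    define L :: complex where "L = of_real (ln (of_nat n))"
    have "(a + b - c - 1) * L = (a * L + b * L) - (c * L + 1 * L)"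
      by (simp add: algebra_simps)
    then have e: "exp ((a + b - c - 1) * L) = exp (a * L) * exp (b * L) / (exp (c * L) * exp (1 * L))"
      by (simp only: exp_add exp_diff)
    have "pochhammer (1 :: complex) n \<noteq> 0"
      by (simp flip: pochhammer_fact)
    then have "hyp_coeff a b c (Suc n) = r n * exp ((a + b - c - 1) * L)"
      unfolding e r_def rGamma_series_def L_def[symmetric] hyp_coeff_def
      by (simp add: pochhammer_fact del: fact_Suc)
    moreover have "norm (exp ((a + b - c - 1) * L)) = real n powr (Re (a + b - c) - 1)"
      using that by (simp add: L_def powr_def mult.commute)
    ultimately show ?thesis
      using M(2)[of n] by (simp add: norm_mult mult_right_mono)
  qed
  with M(1) show thesis by (intro that[of M]) auto
qed

lemma summable_norm_hyp_coeff:
  assumes c: "c \<notin> \<int>\<^sub>\<le>\<^sub>0" and "Re (c - a - b) > 0"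
  shows "summable (\<lambda>n. norm (hyp_coeff a b c n))"
proof -
  obtain M where M: "M \<ge> 0"
    "\<And>n. n > 0 \<Longrightarrow> norm (hyp_coeff a b c (Suc n)) \<le> M * real n powr (Re (a + b - c) - 1)"
    using norm_hyp_coeff_bound[OF c] by blast
  have "summable (\<lambda>n. M * real n powr (Re (a + b - c) - 1))"
    using assms(2) by (intro summable_mult) (simp add: summable_real_powr_iff)
  then have "summable (\<lambda>n. norm (hyp_coeff a b c (Suc n)))"
    by (rule summable_comparison_test_ev[rotated])
      (use eventually_gt_at_top[of 0] in eventually_elim, use M(2) in simp)
  then show ?thesis
    using summable_Suc_iff[of "\<lambda>n. norm (hyp_coeff a b c n)"] by simp
qed

section \<open>Gauss's summation theorem\<close>

text \<open>This disposes of the boundary term at infinity when the contiguous relation at 1 is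
  obtained by telescoping.\<close>

lemma of_nat_mult_hyp_coeff_LIMSEQ:
  assumes c: "c \<notin> \<int>\<^sub>\<le>\<^sub>0" and "Re (c - a - b) > 0"
  shows "(\<lambda>n. of_nat n * hyp_coeff a b c n) \<longlonglongrightarrow> 0"
proof (rule LIMSEQ_imp_Suc)
  obtain M where M: "M \<ge> 0"
    "\<And>n. n > 0 \<Longrightarrow> norm (hyp_coeff a b c (Suc n)) \<le> M * real n powr (Re (a + b - c) - 1)"
    using norm_hyp_coeff_bound[OF c] by blast
  show "(\<lambda>n. of_nat (Suc n) * hyp_coeff a b c (Suc n)) \<longlonglongrightarrow> 0"
  proof (rule Lim_null_comparison)
    show "\<forall>\<^sub>F n in sequentially. norm (of_nat (Suc n) * hyp_coeff a b c (Suc n))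
        \<le> 2 * M * real n powr Re (a + b - c)"
      using eventually_gt_at_top[of 0]
    proof eventually_elim
      case (elim n)
      have "norm (of_nat (Suc n) * hyp_coeff a b c (Suc n))
          \<le> real (Suc n) * (M * real n powr (Re (a + b - c) - 1))"
        using M(2)[OF elim] by (simp add: norm_mult mult_left_mono del: of_nat_Suc)
      also have "\<dots> \<le> (2 * real n) * (M * real n powr (Re (a + b - c) - 1))"
        using elim M(1) by (intro mult_right_mono) auto
      also have "\<dots> = 2 * M * real n powr Re (a + b - c)"
        using elim by (simp add: powr_diff)
      finally show ?case .
    qed
    have "(\<lambda>n. real n powr Re (a + b - c)) \<longlonglongrightarrow> 0"
      using assms(2) by (intro tendsto_neg_powr filterlim_real_sequentially) auto
    then show "(\<lambda>n. 2 * M * real n powr Re (a + b - c)) \<longlonglongrightarrow> 0"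
      by (rule tendsto_mult_right_zero)
  qed
qed

text \<open>
  The difference of the two sides is a telescoping series with partial sums
  \<open>c * of_nat n * hyp_coeff a b c n\<close>.
\<close>

lemma hyp2F1_1_contiguous:
  assumes c: "c \<notin> \<int>\<^sub>\<le>\<^sub>0" and re: "Re (c - a - b) > 0"
  shows "c * (c - a - b) * hyp2F1 a b c 1 = (c - a) * (c - b) * hyp2F1 a b (c + 1) 1"
proof -
  have c1: "c + 1 \<notin> \<int>\<^sub>\<le>\<^sub>0" 
    using c plus_one_in_nonpos_Ints_imp by blast
  have c0: "c \<noteq> 0" using c by auto
  have s0: "hyp_coeff a b c sums hyp2F1 a b c 1"
    unfolding hyp2F1_def using summable_norm_cancel[OF summable_norm_hyp_coeff[OF c re]]
    by (simp add: summable_sums)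
  have s1: "hyp_coeff a b (c + 1) sums hyp2F1 a b (c + 1) 1"
    unfolding hyp2F1_def using summable_norm_cancel[OF summable_norm_hyp_coeff[OF c1, of a b]] re
    by (simp add: summable_sums algebra_simps)
  define T where "T n = c * (of_nat n * hyp_coeff a b c n)" for n
  have "T \<longlonglongrightarrow> 0"
    unfolding T_def by (intro tendsto_mult_right_zero of_nat_mult_hyp_coeff_LIMSEQ c re)
  then have "(\<lambda>n. T (Suc n) - T n) sums (0 - T 0)"
    by (rule telescope_sums)
  moreover have "(\<lambda>n. (c - a) * (c - b) * hyp_coeff a b (c + 1) n - c * (c - a - b) * hyp_coeff a b c n)
      sums ((c - a) * (c - b) * hyp2F1 a b (c + 1) 1 - c * (c - a - b) * hyp2F1 a b c 1)"
    by (intro sums_diff sums_mult s0 s1)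
  moreover have "T (Suc n) - T n
      = (c - a) * (c - b) * hyp_coeff a b (c + 1) n - c * (c - a - b) * hyp_coeff a b c n" for n
  proof -
    define u where "u = hyp_coeff a b c n"
    have nz: "c + of_nat n \<noteq> 0" by (rule plus_of_nat_nonzero[OF c])
    have "c * pochhammer (c + 1) n = pochhammer c n * (c + of_nat n)"
      using pochhammer_rec[of c n] pochhammer_Suc[of c n] by simp
    then have "pochhammer (c + 1) n = pochhammer c n * (c + of_nat n) / c"
      using c0 by (simp add: field_simps)
    then have E1: "hyp_coeff a b (c + 1) n = c / (c + of_nat n) * u"
      using nz c0 unfolding u_def hyp_coeff_def by (simp add: mult_ac)
    have E2: "T n = c * (of_nat n * u)"
      by (simp add: T_def u_def)
    have E3: "T (Suc n) = c * ((a + of_nat n) * (b + of_nat n) * u / (c + of_nat n))"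
      using hyp_coeff_recurrence[OF c, of n a b] nz unfolding T_def u_def
      by (simp add: field_simps del: of_nat_Suc)
    \<comment> \<open>Divided by c u and multiplied by c + n, both sides become ab + (a + b - c)
      n.\<close>
    show ?thesis
      unfolding E1 E2 E3 u_def[symmetric] using nz by (simp add: field_simps)
  qed
  ultimately have "(c - a) * (c - b) * hyp2F1 a b (c + 1) 1 - c * (c - a - b) * hyp2F1 a b c 1 = 0 - T 0"
    using sums_unique2 by auto
  then show ?thesis by (simp add: T_def)
qed

text \<open>Iterating the contiguous relation pushes the third parameter towards infinity. The
  positive real parts keep every divisor c + m and c - a - b + m away from 0.\<close>

lemma hyp2F1_1_shift:
  assumes c: "Re c > 0" and re: "Re (c - a - b) > 0"
  shows "hyp2F1 a b c 1 = pochhammer (c - a) m * pochhammer (c - b) m /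
           (pochhammer c m * pochhammer (c - a - b) m) * hyp2F1 a b (c + of_nat m) 1"
proof (induction m)
  case (Suc m)
  have c': "c + of_nat m \<notin> \<int>\<^sub>\<le>\<^sub>0" and re': "Re (c + of_nat m - a - b) > 0"
    using c re by (auto intro!: not_nonpos_Ints_Re_pos)
  have nz: "c + of_nat m \<noteq> 0" "c - a - b + of_nat m \<noteq> 0"
    using c re by (auto intro!: plus_of_nat_nonzero not_nonpos_Ints_Re_pos)
  have eqs: "c + of_nat m - a = c - a + of_nat m" "c + of_nat m - b = c - b + of_nat m"
    "c - a + of_nat m - b = c - a - b + of_nat m"
    by simp_all
  have "(c + of_nat m) * (c - a - b + of_nat m) * hyp2F1 a b (c + of_nat m) 1
      = (c - a + of_nat m) * (c - b + of_nat m) * hyp2F1 a b (c + of_nat (Suc m)) 1"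
    using hyp2F1_1_contiguous[OF c' re'] unfolding eqs by (simp add: add_ac)
  then have "hyp2F1 a b (c + of_nat m) 1 = (c - a + of_nat m) * (c - b + of_nat m) /
      ((c + of_nat m) * (c - a - b + of_nat m)) * hyp2F1 a b (c + of_nat (Suc m)) 1"
    using nz by (simp add: nonzero_eq_divide_eq mult.commute)
  then show ?case
    unfolding Suc pochhammer_Suc by (simp add: mult_ac)
qed simp

text \<open>Dominated convergence in the form of Tannery's theorem. Since Re c > 0, adding m only
  enlarges the factors of the denominator, so the coefficients for m = 0 are a summable majorant,
  while every coefficient except the constant one tends to 0.\<close>

lemma hyp2F1_1_LIMSEQ_1:
  assumes c: "Re c > 0" and re: "Re (c - a - b) > 0"
  shows "(\<lambda>m. hyp2F1 a b (c + of_nat m) 1) \<longlonglongrightarrow> 1"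
proof -
  define v where "v n = (if n = 0 then 1 else 0 :: complex)" for n :: nat
  have c': "c \<notin> \<int>\<^sub>\<le>\<^sub>0" by (rule not_nonpos_Ints_Re_pos[OF c])
  have poch_le: "norm (pochhammer c n) \<le> norm (pochhammer (c + of_nat m) n)" for n m
    unfolding pochhammer_prod prod_norm[symmetric]
  proof (intro prod_mono conjI norm_ge_zero)
    fix i
    show "norm (c + of_nat i) \<le> norm (c + of_nat m + of_nat i)"
      unfolding cmod_def using c by (auto intro!: real_sqrt_le_mono power_mono)
  qed
  have bound: "norm (hyp_coeff a b (c + of_nat m) n) \<le> norm (hyp_coeff a b c n)" for n m
    unfolding hyp_coeff_def norm_divide norm_mult
    using poch_le[of n m] pochhammer_nonzero[OF c', of n]
    by (intro divide_left_mono mult_right_mono mult_pos_pos) auto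
  have lim: "(\<lambda>m. hyp_coeff a b (c + of_nat m) n) \<longlonglongrightarrow> v n" for n
  proof (cases n)
    case (Suc k)
    \<comment> \<open>The last factor c + m + k of the Pochhammer symbol has modulus at least m; the
      other k factors are bounded below by \<open>poch_le\<close>.\<close>
    define K where "K = norm (pochhammer a n * pochhammer b n) / (norm (pochhammer c k) * fact n)"
    have "(\<lambda>m. hyp_coeff a b (c + of_nat m) n) \<longlonglongrightarrow> 0"
    proof (rule Lim_null_comparison)
      show "(\<lambda>m. K / real m) \<longlonglongrightarrow> 0"
        by (rule lim_const_over_n)
      show "\<forall>\<^sub>F m in sequentially. norm (hyp_coeff a b (c + of_nat m) n) \<le> K / real m"
        using eventually_gt_at_top[of 0]
      proof eventually_elim
        case (elim m)
        have "real m \<le> Re (c + of_nat m + of_nat k)"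
          using c by simp
        also have "\<dots> \<le> norm (c + of_nat m + of_nat k)"
          by (rule complex_Re_le_cmod)
        finally have "norm (pochhammer c k) * real m \<le> norm (pochhammer (c + of_nat m) n)"
          using poch_le[of k m] by (simp add: Suc pochhammer_Suc norm_mult mult_mono)
        then have "norm (hyp_coeff a b (c + of_nat m) n)
            \<le> norm (pochhammer a n * pochhammer b n) / (norm (pochhammer c k) * real m * fact n)"
          unfolding hyp_coeff_def norm_divide norm_mult
          using elim pochhammer_nonzero[OF c', of k]
          by (intro divide_left_mono) (auto intro!: mult_right_mono mult_pos_pos
              elim: less_le_trans[rotated])
        then show ?case by (simp add: K_def mult_ac)
      qed
    qed
    then show ?thesis by (simp add: v_def Suc)
  qed (simp add: v_def)
  have "\<forall>\<^sub>F (n, m) in sequentially \<times>\<^sub>F sequentially.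
      norm (hyp_coeff a b (c + of_nat m) n) \<le> norm (hyp_coeff a b c n)"
    by (rule always_eventually) (auto intro: bound)
  then have "(\<lambda>m. \<Sum>n. hyp_coeff a b (c + of_nat m) n) \<longlonglongrightarrow> suminf v"
    using tannerys_theorem[where a = "\<lambda>n m. hyp_coeff a b (c + of_nat m) n" and b = v
        and F = sequentially and M = "\<lambda>n. norm (hyp_coeff a b c n)", OF lim]
      summable_norm_hyp_coeff[OF c' re] by simp
  moreover have "v sums 1"
    using sums_single[of 0 "\<lambda>_. 1 :: complex"] by (simp add: v_def[abs_def])
  then have "suminf v = 1"
    by (simp add: sums_iff)
  ultimately show ?thesis by (simp add: hyp2F1_def)
qed

text \<open>The left side of \<open>hyp2F1_1_shift\<close> does not depend on m, and its prefactor
  is balanced because (c - a) + (c - b) = c + (c - a - b). The entire function \<open>rGamma\<close>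
  keeps the formula meaningful where c - a or c - b is a pole of Gamma.\<close>

theorem gauss_summation:
  assumes c: "Re c > 0" and re: "Re (c - a - b) > 0"
  shows "hyp2F1 a b c 1 = Gamma c * Gamma (c - a - b) * rGamma (c - a) * rGamma (c - b)"
proof (rule LIMSEQ_unique)
  have "c \<notin> \<int>\<^sub>\<le>\<^sub>0" "c - a - b \<notin> \<int>\<^sub>\<le>\<^sub>0"
    using c re by (auto intro!: not_nonpos_Ints_Re_pos)
  then have "(\<lambda>m. pochhammer (c - a) m * pochhammer (c - b) m /
      (pochhammer c m * pochhammer (c - a - b) m) * hyp2F1 a b (c + of_nat m) 1)
      \<longlonglongrightarrow> Gamma c * Gamma (c - a - b) * rGamma (c - a) * rGamma (c - b) * 1"
    by (intro tendsto_mult pochhammer_ratio_LIMSEQ hyp2F1_1_LIMSEQ_1 c re) auto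
  then show "(\<lambda>m. hyp2F1 a b c 1)
      \<longlonglongrightarrow> Gamma c * Gamma (c - a - b) * rGamma (c - a) * rGamma (c - b)"
    using hyp2F1_1_shift[OF c re] by simp
qed simp

section \<open>One-sided limits at t = 1, convergent and singular case\<close>

text \<open>For 0 < t < 1 the terms are dominated by the absolute values of the coefficients, which
  are summable in this parameter range.\<close>

lemma hyp2F1_tendsto_at_left_1:
  assumes c: "c \<notin> \<int>\<^sub>\<le>\<^sub>0" and re: "Re (c - a - b) > 0"
  shows "((\<lambda>t. hyp2F1 a b c (of_real t)) \<longlongrightarrow> hyp2F1 a b c 1) (at_left 1)"
proof -
  have lim: "((\<lambda>t. hyp_coeff a b c n * of_real t ^ n) \<longlongrightarrow> hyp_coeff a b c n * 1 ^ n) (at_left (1::real))" for n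
  proof -
    have "((\<lambda>t. hyp_coeff a b c n * of_real t ^ n) \<longlongrightarrow> hyp_coeff a b c n * of_real 1 ^ n) (at_left (1::real))"
      by (intro tendsto_intros)
    then show ?thesis by simp
  qed
  have "\<forall>\<^sub>F t in at_left (1::real). t \<in> {0<..<1}"
    by (rule eventually_at_leftI[of 0]) auto
  then have "\<forall>\<^sub>F t in at_left (1::real). \<forall>n. norm (hyp_coeff a b c n * of_real t ^ n) \<le> norm (hyp_coeff a b c n)"
    by eventually_elim (auto simp: norm_mult norm_power power_le_one intro!: mult_left_le)
  then have "\<forall>\<^sub>F (n, t) in at_top \<times>\<^sub>F at_left (1::real).
      norm (hyp_coeff a b c n * of_real t ^ n) \<le> norm (hyp_coeff a b c n)"
    unfolding eventually_prod_filter 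
    by (intro exI[of _ "\<lambda>_. True"] exI) auto
  from tannerys_theorem[OF lim this summable_norm_hyp_coeff[OF c re]]
  show ?thesis by (simp add: hyp2F1_def)
qed

text \<open>The binomial series for (1 - t) to the complex power - s. The power is written with the
  real logarithm, so that no branch has to be discussed later.\<close>

lemma pochhammer_over_fact_sums:
  fixes s :: complex
  assumes "0 \<le> t" "t < 1"
  shows "(\<lambda>n. pochhammer s n / fact n * of_real t ^ n) sums exp (- s * of_real (ln (1 - t)))"
proof -
  have "(\<lambda>n. ((- s) gchoose n) * (- of_real t) ^ n) sums (1 + (- of_real t)) powr (- s)"
    using assms by (intro gen_binomial_complex) auto
  moreover have "((- s) gchoose n) * (- of_real t) ^ n = pochhammer s n / fact n * of_real t ^ n" for n
  proof -
    have "((- s) gchoose n) * (- of_real t) ^ n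
        = ((- 1) ^ n * (- 1) ^ n) * (pochhammer s n / fact n * of_real t ^ n)"
      unfolding gbinomial_pochhammer power_minus[of "of_real t :: complex"] minus_minus
      by (simp only: times_divide_eq_left times_divide_eq_right mult_ac)
    also have "(- 1) ^ n * (- 1) ^ n = (1 :: complex)"
      unfolding power_mult_distrib[symmetric] by simp
    finally show ?thesis by simp
  qed
  moreover have "(1 + (- of_real t :: complex)) powr (- s) = exp (- s * of_real (ln (1 - t)))"
  proof -
    have "(1 + (- of_real t :: complex)) = of_real (1 - t)" by simp
    then show ?thesis
      using assms by (simp add: powr_def Ln_of_real del: of_real_diff)
  qed
  ultimately show ?thesis by simp
qed

text \<open>An Abelian theorem: if d is little-o of the positive p, the same holds for the
  generating functions as t tends to 1, provided that of p diverges.\<close>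

lemma abelian_little_o:
  fixes d :: "nat \<Rightarrow> complex" and p :: "nat \<Rightarrow> real"
  assumes p: "\<And>n. p n > 0" "\<And>t. 0 \<le> t \<Longrightarrow> t < 1 \<Longrightarrow> (\<lambda>n. p n * t ^ n) sums S t"
    and S: "filterlim S at_top (at_left 1)"
    and d: "(\<lambda>n. d n / of_real (p n)) \<longlonglongrightarrow> 0"
  shows "((\<lambda>t. (\<Sum>n. d n * of_real t ^ n) / of_real (S t)) \<longlongrightarrow> 0) (at_left 1)"
proof (rule tendstoI)
  fix e :: real assume e: "e > 0"
  have "\<forall>\<^sub>F n in sequentially. norm (d n / of_real (p n)) < e / 2"
    using order_tendstoD(2)[OF tendsto_norm[OF d], of "e / 2"] e by simp
  then obtain N where N: "\<And>n. n \<ge> N \<Longrightarrow> norm (d n / of_real (p n)) < e / 2"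
    by (auto simp: eventually_sequentially)
  have dle: "norm (d n) \<le> e / 2 * p n" if "n \<ge> N" for n
    using N[OF that] p(1)[of n] by (simp add: norm_divide field_simps)
  \<comment> \<open>The head below N contributes at most C, which is less than e/2 times S t once S
    t > 2 C / e; the tail contributes at most e/2 times S t.\<close>
  define C where "C = (\<Sum>n<N. norm (d n))"
  have "\<forall>\<^sub>F t in at_left 1. S t > 2 * C / e" "\<forall>\<^sub>F t in at_left 1. S t > 0"
    using S by (auto simp: filterlim_at_top_dense)
  moreover have "\<forall>\<^sub>F t in at_left (1::real). t \<in> {0<..<1}"
    by (rule eventually_at_leftI[of 0]) auto
  ultimately show "\<forall>\<^sub>F t in at_left 1. dist ((\<Sum>n. d n * of_real t ^ n) / of_real (S t)) 0 < e"
  proof eventually_elim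
    case (elim t)
    then have t: "0 < t" "t < 1" by auto
    have ps: "(\<lambda>n. p n * t ^ n) sums S t"
      using p(2) t by simp
    define w where "w n = (if n < N then norm (d n) else 0)" for n
    have w: "w sums C"
      using sums_If_finite_set[of "{..<N}" "\<lambda>n. norm (d n)"] by (simp add: w_def[abs_def] C_def)
    have le: "norm (d n * of_real t ^ n) \<le> w n + e / 2 * (p n * t ^ n)" for n
    proof (cases "n < N")
      case True
      have "norm (d n) * t ^ n \<le> norm (d n)"
        using t by (simp add: mult_left_le power_le_one)
      then show ?thesis
        using True e t p(1)[of n] by (simp add: w_def norm_mult norm_power add_increasing2)
    next
      case False
      then show ?thesis
        using mult_right_mono[OF dle[of n], of "t ^ n"] t
        by (simp add: w_def norm_mult norm_power mult_ac)
    qed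
    have maj: "(\<lambda>n. w n + e / 2 * (p n * t ^ n)) sums (C + e / 2 * S t)"
      by (intro sums_add sums_mult w ps)
    have "norm (\<Sum>n. d n * of_real t ^ n) \<le> C + e / 2 * S t"
      using norm_suminf_le[OF le sums_summable[OF maj]] sums_unique[OF maj] by simp
    also have "\<dots> < e * S t"
      using elim e by (simp add: field_simps)
    finally show ?case
      using elim by (simp add: norm_divide field_simps)
  qed
qed

text \<open>
  The coefficients are asymptotic to a multiple of those of \<open>(1 - t) powr (- s)\<close>, so that
  \<open>abelian_little_o\<close>, with the majorant \<open>(1 - t) powr (- Re s)\<close>, bounds the difference.
\<close>

theorem hyp2F1_asymp_at_left_1:
  assumes c: "c \<notin> \<int>\<^sub>\<le>\<^sub>0" and s: "s = a + b - c" "Re s > 0"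
  shows "((\<lambda>t. exp (s * of_real (ln (1 - t))) * hyp2F1 a b c (of_real t))
           \<longlongrightarrow> Gamma c * Gamma s * rGamma a * rGamma b) (at_left 1)"
proof -
  define R where "R = Gamma c * Gamma s * rGamma a * rGamma b"
  define p where "p n = pochhammer (Re s) n / fact n" for n
  define w where "w n = pochhammer s n / fact n" for n
  define d where "d n = hyp_coeff a b c n - R * w n" for n
  define S where "S t = exp (- Re s * ln (1 - t))" for t :: real
  have snz: "s \<notin> \<int>\<^sub>\<le>\<^sub>0" by (rule not_nonpos_Ints_Re_pos[OF s(2)])
  have ppos: "p n > 0" for n
    unfolding p_def using s by (intro divide_pos_pos pochhammer_pos) auto
  have psums: "(\<lambda>n. p n * t ^ n) sums S t" if "0 \<le> t" "t < 1" for t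
  proof -
    have "exp (- of_real (Re s) * of_real (ln (1 - t))) = complex_of_real (S t)"
      by (simp add: S_def flip: exp_of_real)
    then have "(\<lambda>n. complex_of_real (p n * t ^ n)) sums complex_of_real (S t)"
      using pochhammer_over_fact_sums[OF that, of "of_real (Re s)"]
      by (simp add: p_def flip: pochhammer_of_real)
    then show ?thesis by (simp only: sums_of_real_iff)
  qed
  have S: "filterlim S at_top (at_left 1)"
  proof -
    have "filterlim (\<lambda>t::real. 1 - t) (at_right 0) (at_left 1)"
      unfolding filterlim_at by (auto intro!: tendsto_eq_intros eventually_at_leftI[of 0])
    then have "filterlim (\<lambda>t::real. ln (1 - t)) at_bot (at_left 1)"
      by (rule filterlim_compose[OF ln_at_0])
    then have "filterlim (\<lambda>t::real. Re s * - ln (1 - t)) at_top (at_left 1)"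
      by (intro filterlim_tendsto_pos_mult_at_top[OF tendsto_const s(2)])
        (simp add: filterlim_uminus_at_top)
    then have "filterlim (\<lambda>t::real. - Re s * ln (1 - t)) at_top (at_left 1)"
      by simp
    then show ?thesis
      unfolding S_def by (rule filterlim_compose[OF exp_at_top])
  qed
  have dlim: "(\<lambda>n. d n / of_real (p n)) \<longlonglongrightarrow> 0"
  proof -
    \<comment> \<open>The parameters are balanced, a + b = c + s, so r tends to R. As d = (r - R) w,
      it remains to see that w / p is bounded.\<close>
    define r where "r n = pochhammer a n * pochhammer b n / (pochhammer c n * pochhammer s n)" for n
    have r: "r \<longlonglongrightarrow> R"
      unfolding r_def R_def by (rule pochhammer_ratio_LIMSEQ) (use c snz s in auto)
    \<comment> \<open>The normalising powers of n with exponents s and Re s have equal modulus, so w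
      / p has the modulus of a convergent quotient.\<close>
    define v where "v n = rGamma_series s n / rGamma_series (of_real (Re s)) n" for n
    have "v \<longlonglongrightarrow> rGamma s / rGamma (of_real (Re s))"
      unfolding v_def using not_nonpos_Ints_Re_pos[of "of_real (Re s)"] s(2)
      by (intro tendsto_divide rGamma_series_LIMSEQ) (simp add: rGamma_eq_zero_iff)
    then have "Bseq v" by (intro convergent_imp_Bseq convergentI)
    have wp: "norm (w (Suc n) / of_real (p (Suc n))) = norm (v n)" for n
    proof -
      have "norm (exp (s * of_real (ln (real n)))) = norm (exp (complex_of_real (Re s) * of_real (ln (real n))))"
        by simp
      moreover have "1 + complex_of_nat n \<noteq> 0"
        by (metis of_nat_Suc of_nat_neq_0)
      ultimately show ?thesis
        by (simp add: w_def p_def v_def rGamma_series_def norm_divide norm_mult flip: pochhammer_of_real)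
    qed
    have "Bseq (\<lambda>n. w (Suc n) / of_real (p (Suc n)))"
      using \<open>Bseq v\<close> unfolding Bseq_def wp .
    then have "Bseq (\<lambda>n. w n / of_real (p n))"
      using Bseq_Suc_iff[of "\<lambda>n. w n / of_real (p n)"] by simp
    then obtain K where K: "\<And>n. norm (w n / of_real (p n)) \<le> K"
      by (auto simp: Bseq_def)
    have "(\<lambda>n. r n - R) \<longlonglongrightarrow> 0"
      using r by (simp add: LIM_zero_iff)
    then have "(\<lambda>n. (r n - R) * (w n / of_real (p n))) \<longlonglongrightarrow> 0"
      by (rule lim_null_mult_right_bounded[where B = K]) (use K in auto)
    moreover have "(r n - R) * w n = d n" for n
      using pochhammer_nonzero[OF snz, of n] by (simp add: r_def w_def d_def hyp_coeff_def field_simps)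
    ultimately show ?thesis by simp
  qed
  have lim0: "((\<lambda>t. (\<Sum>n. d n * of_real t ^ n) / of_real (S t)) \<longlongrightarrow> 0) (at_left 1)"
    by (rule abelian_little_o[OF ppos psums S dlim])
  have ev: "\<forall>\<^sub>F t in at_left (1::real). t \<in> {0<..<1}"
    by (rule eventually_at_leftI[of 0]) auto
  have "((\<lambda>t. exp (s * of_real (ln (1 - t))) * hyp2F1 a b c (of_real t) - R) \<longlongrightarrow> 0) (at_left 1)"
  proof (rule Lim_null_comparison)
    show "((\<lambda>t. norm ((\<Sum>n. d n * of_real t ^ n) / of_real (S t))) \<longlongrightarrow> 0) (at_left 1)"
      using lim0 by (rule tendsto_norm_zero)
    show "\<forall>\<^sub>F t in at_left 1. norm (exp (s * of_real (ln (1 - t))) * hyp2F1 a b c (of_real t) - R)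
        \<le> norm ((\<Sum>n. d n * of_real t ^ n) / of_real (S t))"
      using ev
    proof eventually_elim
      case (elim t)
      define X where "X = exp (s * of_real (ln (1 - t)))"
      have X: "X * exp (- s * of_real (ln (1 - t))) = 1"
        by (simp add: X_def flip: exp_add)
      have "(\<lambda>n. hyp_coeff a b c n * of_real t ^ n - R * (w n * of_real t ^ n))
          sums (hyp2F1 a b c (of_real t) - R * exp (- s * of_real (ln (1 - t))))"
        unfolding hyp2F1_def w_def using elim
        by (intro sums_diff sums_mult summable_sums summable_hyp_coeff c pochhammer_over_fact_sums) auto
      then have "(\<Sum>n. d n * of_real t ^ n) = hyp2F1 a b c (of_real t) - R * exp (- s * of_real (ln (1 - t)))"
        by (simp add: d_def sums_iff algebra_simps)
      then have "X * (\<Sum>n. d n * of_real t ^ n)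
          = X * hyp2F1 a b c (of_real t) - R * (X * exp (- s * of_real (ln (1 - t))))"
        by (simp only: right_diff_distrib mult.left_commute)
      then have "X * hyp2F1 a b c (of_real t) - R = X * (\<Sum>n. d n * of_real t ^ n)"
        unfolding X mult_1_right by (rule sym)
      moreover have "norm X = 1 / S t"
        by (simp add: X_def S_def exp_minus field_simps)
      ultimately show ?case
        unfolding X_def[symmetric] by (simp add: norm_mult norm_divide S_def)
    qed
  qed
  then show ?thesis
    unfolding R_def by (rule LIM_zero_cancel)
qed

section \<open>The Zakharov--Shabat system with a hyperbolic secant potential\<close>

text \<open>The phases come from conjugation by exp(-i mu x sigma3). No conjugate of g occurs, so
  one system serves both signs of the nonlinearity.\<close>

definition zs_solution ::
  "real \<Rightarrow> complex \<Rightarrow> real \<Rightarrow> (real \<Rightarrow> complex) \<Rightarrow> (real \<Rightarrow> complex) \<Rightarrow> bool" where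
  "zs_solution A g \<mu> \<alpha> \<beta> \<longleftrightarrow> (\<forall>x.
     (\<alpha> has_vector_derivative g * of_real (A / cosh (A * x)) * exp (2 * \<i> * of_real (\<mu> * x)) * \<beta> x) (at x) \<and>
     (\<beta> has_vector_derivative - g * of_real (A / cosh (A * x)) * exp (- 2 * \<i> * of_real (\<mu> * x)) * \<alpha> x) (at x))"

text \<open>Oriented so that x at plus infinity, where the Jost solution is normalised, corresponds
  to the centre t = 0 of the series.\<close>

definition zs_t :: "real \<Rightarrow> real \<Rightarrow> real" where
  "zs_t A x = (1 - tanh (A * x)) / 2"

text \<open>
  Solution tending to \<open>(0, 1)\<close> as \<open>x \<rightarrow> \<infinity>\<close>. Eliminating \<open>\<alpha>\<close> from the system and substituting
  \<open>t = (1 - tanh (A x)) / 2\<close> turns the equation for \<open>\<beta>\<close> into the hypergeometric equation with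
  parameters \<open>g, -g\<close> and \<open>\<gamma> = 1/2 - i \<mu> / A\<close>; the second equation of the system then gives \<open>\<alpha>\<close>.
\<close>

definition zs_beta :: "real \<Rightarrow> complex \<Rightarrow> real \<Rightarrow> real \<Rightarrow> complex" where
  "zs_beta A g \<mu> x = hyp2F1 g (- g) (1/2 - \<i> * of_real (\<mu> / A)) (of_real (zs_t A x))"

definition zs_alpha :: "real \<Rightarrow> complex \<Rightarrow> real \<Rightarrow> real \<Rightarrow> complex" where
  "zs_alpha A g \<mu> x =
     - g / (1/2 - \<i> * of_real (\<mu> / A)) * (exp (2 * \<i> * of_real (\<mu> * x)) / of_real (2 * cosh (A * x))) *
     hyp2F1 (g + 1) (- g + 1) (1/2 - \<i> * of_real (\<mu> / A) + 1) (of_real (zs_t A x))"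

lemma zs_t_bounds: "0 < zs_t A x" "zs_t A x < 1"
  using tanh_real_bounds[of "A * x"] by (auto simp: zs_t_def)

lemma zs_t_eq: "zs_t A x = exp (- (A * x)) / (2 * cosh (A * x))"
  and one_minus_zs_t_eq: "1 - zs_t A x = exp (A * x) / (2 * cosh (A * x))"
proof -
  have "cosh (A * x) \<noteq> 0" by simp
  then show "zs_t A x = exp (- (A * x)) / (2 * cosh (A * x))"
      "1 - zs_t A x = exp (A * x) / (2 * cosh (A * x))"
    unfolding zs_t_def tanh_def cosh_minus_sinh[symmetric] cosh_plus_sinh[symmetric]
    by (auto simp: divide_simps)
qed

text \<open>Through this identity the 1 / cosh^2 of the chain rule becomes the leading coefficient z
  (1 - z) of the hypergeometric equation.\<close>

lemma zs_t_mult: "zs_t A x * (1 - zs_t A x) = 1 / (4 * (cosh (A * x))\<^sup>2)"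
  unfolding one_minus_zs_t_eq unfolding zs_t_eq by (simp add: power2_eq_square exp_minus)

lemma zs_t_has_derivative:
  "(zs_t A has_real_derivative - A / (2 * (cosh (A * x))\<^sup>2)) (at x)"
proof -
  have "1 - (tanh (A * x))\<^sup>2 = 4 * (zs_t A x * (1 - zs_t A x))"
    by (simp add: zs_t_def field_simps power2_eq_square)
  then have sq: "1 - (tanh (A * x))\<^sup>2 = 1 / (cosh (A * x))\<^sup>2"
    unfolding zs_t_mult by simp
  have "(zs_t A has_real_derivative - (A * (1 - (tanh (A * x))\<^sup>2)) / 2) (at x)"
    unfolding zs_t_def[abs_def] by (auto intro!: derivative_eq_intros)
  then show ?thesis
    unfolding sq by (simp add: field_simps)
qed

lemma hyp2F1_zs_t_has_vector_derivative:
  assumes "Re c > 0"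
  shows "((\<lambda>x. hyp2F1 a b c (of_real (zs_t A x))) has_vector_derivative
     of_real (- A / (2 * (cosh (A * x))\<^sup>2)) *
       (a * b / c * hyp2F1 (a + 1) (b + 1) (c + 1) (of_real (zs_t A x)))) (at x)"
proof -
  have d: "((\<lambda>x. complex_of_real (zs_t A x)) has_vector_derivative
      of_real (- A / (2 * (cosh (A * x))\<^sup>2))) (at x)"
    using zs_t_has_derivative[of A x]
    by (intro has_vector_derivative_of_real) (simp only: has_real_derivative_iff_has_vector_derivative)
  have "norm (complex_of_real (zs_t A x)) < 1"
    using zs_t_bounds[of A x] by simp
  from field_vector_diff_chain_at[OF d hyp2F1_has_field_derivative[OF not_nonpos_Ints_Re_pos[OF assms] this]]
  show ?thesis unfolding o_def .
qed

lemma exp_i_has_vector_derivative: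
  fixes w :: complex
  shows "((\<lambda>x. exp (w * of_real (\<mu> * x))) has_vector_derivative
      w * of_real \<mu> * exp (w * of_real (\<mu> * x))) (at x)"
proof -
  have "((\<lambda>z. exp (w * (of_real \<mu> * z))) has_field_derivative
      w * of_real \<mu> * exp (w * (of_real \<mu> * of_real x))) (at (of_real x))"
    by (auto intro!: derivative_eq_intros)
  from has_vector_derivative_real_field[OF this] show ?thesis by simp
qed

text \<open>The equation for beta is the chain rule, by the choice of \<open>zs_alpha\<close>; the
  equation for alpha is the hypergeometric equation.\<close>

lemma zs_solution_zs:
  assumes A: "A \<noteq> 0"
  shows "zs_solution A g \<mu> (zs_alpha A g \<mu>) (zs_beta A g \<mu>)"
  unfolding zs_solution_def
proof (intro allI conjI)
  fix x :: real
  define \<gamma> where "\<gamma> = 1/2 - \<i> * of_real (\<mu> / A)"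
  have \<gamma>: "Re \<gamma> > 0" "\<gamma> \<noteq> 0" by (auto simp: \<gamma>_def complex_eq_iff)
  define t :: complex where "t = of_real (zs_t A x)"
  define C :: complex where "C = of_real (cosh (A * x))"
  define T :: complex where "T = of_real (tanh (A * x))"
  have C: "C \<noteq> 0" by (simp add: C_def)
  define e where "e = exp (2 * \<i> * of_real (\<mu> * x))"
  have e: "exp (- 2 * \<i> * of_real (\<mu> * x)) * e = 1"
    by (simp add: e_def flip: exp_add)
  define H where "H = (\<lambda>x. hyp2F1 (g + 1) (- g + 1) (\<gamma> + 1) (of_real (zs_t A x)))"
  define H' where "H' = (g + 1) * (- g + 1) / (\<gamma> + 1) * hyp2F1 (g + 2) (- g + 2) (\<gamma> + 2) t"
  have coef: "of_real (- A / (2 * (cosh (A * x))\<^sup>2)) = - of_real A / (2 * C\<^sup>2)"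
    by (simp add: C_def)
  have dH: "(H has_vector_derivative - of_real A / (2 * C\<^sup>2) * H') (at x)"
    using hyp2F1_zs_t_has_vector_derivative[of "\<gamma> + 1" "g + 1" "- g + 1" A x] \<gamma>
    unfolding coef H_def H'_def t_def by (simp add: add.assoc)
  have alpha: "zs_alpha A g \<mu> = (\<lambda>x. - g / \<gamma> * (exp (2 * \<i> * of_real (\<mu> * x)) * of_real (1 / (2 * cosh (A * x))) * H x))"
    by (simp add: zs_alpha_def fun_eq_iff H_def \<gamma>_def)
  \<comment> \<open>The hypergeometric equation carries the common factor - g^2 / gamma, which has
    to be divided out.\<close>
  have ode: "t * (1 - t) * H' + (\<gamma> - t) * H x = \<gamma> * zs_beta A g \<mu> x" if "g \<noteq> 0"
  proof -
    have t: "norm t < 1" using zs_t_bounds[of A x] by (simp add: t_def)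
    have "t * (1 - t) * (g * (- g) / \<gamma> * H') + (\<gamma> - (g + - g + 1) * t) * (g * (- g) / \<gamma> * H x)
        - g * (- g) * zs_beta A g \<mu> x = 0"
      unfolding zs_beta_def \<gamma>_def[symmetric] t_def[symmetric]
      by (rule hyp2F1_ode[OF not_nonpos_Ints_Re_pos[OF \<gamma>(1)] t]) (simp_all add: H_def H'_def t_def)
    moreover have "t * (1 - t) * (g * (- g) / \<gamma> * H') + (\<gamma> - (g + - g + 1) * t) * (g * (- g) / \<gamma> * H x)
        - g * (- g) * zs_beta A g \<mu> x
        = - (g * g / \<gamma>) * (t * (1 - t) * H' + (\<gamma> - t) * H x - \<gamma> * zs_beta A g \<mu> x)"
      using \<gamma>(2) by (simp add: field_simps)
    ultimately show ?thesis using that \<gamma>(2) by simp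
  qed
  have "(zs_beta A g \<mu> has_vector_derivative
      - of_real A / (2 * C\<^sup>2) * (g * - g / \<gamma> * H x)) (at x)"
    using hyp2F1_zs_t_has_vector_derivative[of \<gamma> g "- g" A x] \<gamma>
    unfolding coef H_def zs_beta_def[abs_def] \<gamma>_def[symmetric] by simp
  moreover have "- of_real A / (2 * C\<^sup>2) * (g * - g / \<gamma> * H x)
      = - g * of_real (A / cosh (A * x)) * exp (- 2 * \<i> * of_real (\<mu> * x)) * zs_alpha A g \<mu> x"
  proof -
    have "- g * of_real (A / cosh (A * x)) * exp (- 2 * \<i> * of_real (\<mu> * x)) * zs_alpha A g \<mu> x
      = (exp (- 2 * \<i> * of_real (\<mu> * x)) * e) * (- g * (of_real A / C) * (- g / \<gamma> * (1 / (2 * C) * H x)))"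
      unfolding alpha e_def[symmetric] by (simp add: C_def)
    also have "\<dots> = - of_real A / (2 * C\<^sup>2) * (g * - g / \<gamma> * H x)"
      unfolding e using C by (simp add: power2_eq_square mult_ac)
    finally show ?thesis ..
  qed
  ultimately show "(zs_beta A g \<mu> has_vector_derivative
      - g * of_real (A / cosh (A * x)) * exp (- 2 * \<i> * of_real (\<mu> * x)) * zs_alpha A g \<mu> x) (at x)"
    by simp
  have dcosh: "((\<lambda>x. complex_of_real (1 / (2 * cosh (A * x)))) has_vector_derivative - (of_real A * T / (2 * C))) (at x)"
  proof -
    have "((\<lambda>x. 1 / (2 * cosh (A * x))) has_real_derivative - (A * tanh (A * x) / (2 * cosh (A * x)))) (at x)"
      by (auto intro!: derivative_eq_intros simp: tanh_def field_simps power2_eq_square)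
    from has_vector_derivative_of_real[OF this, where 'a = complex]
    show ?thesis by (simp add: T_def C_def)
  qed
  have "(zs_alpha A g \<mu> has_vector_derivative
     - g / \<gamma> * ((exp (2 * \<i> * of_real (\<mu> * x)) * of_real (1 / (2 * cosh (A * x)))) * (- of_real A / (2 * C\<^sup>2) * H')
       + (exp (2 * \<i> * of_real (\<mu> * x)) * - (of_real A * T / (2 * C)) +
          2 * \<i> * of_real \<mu> * exp (2 * \<i> * of_real (\<mu> * x)) * of_real (1 / (2 * cosh (A * x)))) * H x)) (at x)"
    unfolding alpha
    by (intro has_vector_derivative_mult_right has_vector_derivative_mult dH dcosh exp_i_has_vector_derivative)
  moreover have "- g / \<gamma> * ((exp (2 * \<i> * of_real (\<mu> * x)) * of_real (1 / (2 * cosh (A * x)))) * (- of_real A / (2 * C\<^sup>2) * H')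
       + (exp (2 * \<i> * of_real (\<mu> * x)) * - (of_real A * T / (2 * C)) +
          2 * \<i> * of_real \<mu> * exp (2 * \<i> * of_real (\<mu> * x)) * of_real (1 / (2 * cosh (A * x)))) * H x)
     = g * of_real (A / cosh (A * x)) * exp (2 * \<i> * of_real (\<mu> * x)) * zs_beta A g \<mu> x"
  \<comment> \<open>For g = 0 both sides contain the factor g and vanish.\<close>
  proof (cases "g = 0")
    case False
    define B where "B = zs_beta A g \<mu> x"
    have tt: "t * (1 - t) = 1 / (4 * C\<^sup>2)"
    proof -
      have "t * (1 - t) = of_real (zs_t A x * (1 - zs_t A x))" by (simp add: t_def)
      then show ?thesis unfolding zs_t_mult by (simp add: C_def)
    qed
    have H': "- of_real A / (2 * C\<^sup>2) * H' = 2 * of_real A * ((\<gamma> - t) * H x - \<gamma> * B)"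
    proof -
      have e: "1 / (4 * C\<^sup>2) * H' = \<gamma> * B - (\<gamma> - t) * H x"
        using ode[OF False] unfolding tt B_def[symmetric] eq_diff_eq .
      have "- of_real A / (2 * C\<^sup>2) * H' = - 2 * of_real A * (1 / (4 * C\<^sup>2) * H')"
        by simp
      then show ?thesis unfolding e by (simp add: algebra_simps)
    qed
    have tT: "t = (1 - T) / 2" by (simp add: t_def T_def zs_t_def)
    \<comment> \<open>This explains \<open>\<gamma>\<close>: its real part 1/2 cancels the tanh
      terms and its imaginary part cancels 2 i mu from the phase, so that the coefficient of
      \<open>H x\<close> below is 0.\<close>
    have \<gamma>A: "of_real A * \<gamma> = of_real A / 2 - \<i> * of_real \<mu>"
      using A by (simp add: \<gamma>_def field_simps)
    have "2 * of_real A * ((\<gamma> - t) * H x - \<gamma> * B) + (2 * \<i> * of_real \<mu> - of_real A * T) * H x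
      = (2 * (of_real A * \<gamma>) - 2 * of_real A * t + 2 * \<i> * of_real \<mu> - of_real A * T) * H x - 2 * of_real A * \<gamma> * B"
      by (simp add: algebra_simps)
    also have "\<dots> = - 2 * of_real A * \<gamma> * B"
      unfolding \<gamma>A tT by (simp add: field_simps)
    finally have main: "2 * of_real A * ((\<gamma> - t) * H x - \<gamma> * B) + (2 * \<i> * of_real \<mu> - of_real A * T) * H x
      = - 2 * of_real A * \<gamma> * B" .
    have half: "complex_of_real (1 / (2 * cosh (A * x))) = 1 / (2 * C)" "complex_of_real (A / cosh (A * x)) = of_real A / C"
      by (simp_all add: C_def)
    have "- g / \<gamma> * (e * (1 / (2 * C)) * (- of_real A / (2 * C\<^sup>2) * H')
       + (e * - (of_real A * T / (2 * C)) + 2 * \<i> * of_real \<mu> * e * (1 / (2 * C))) * H x)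
      = - g / \<gamma> * (e / (2 * C) * (2 * of_real A * ((\<gamma> - t) * H x - \<gamma> * B) + (2 * \<i> * of_real \<mu> - of_real A * T) * H x))"
    proof -
      have "e * (1 / (2 * C)) * Y + (e * - (of_real A * T / (2 * C)) + 2 * \<i> * of_real \<mu> * e * (1 / (2 * C))) * H x
          = e / (2 * C) * (Y + (2 * \<i> * of_real \<mu> - of_real A * T) * H x)" for Y
        by (simp add: algebra_simps add_divide_distrib diff_divide_distrib)
      then show ?thesis unfolding H' by (rule arg_cong)
    qed
    also have "\<dots> = g * (of_real A / C) * e * B"
      unfolding main using C \<gamma>(2) by simp
    finally show ?thesis unfolding half e_def[symmetric] B_def[symmetric] .
  qed simp
  ultimately show "(zs_alpha A g \<mu> has_vector_derivative
      g * of_real (A / cosh (A * x)) * exp (2 * \<i> * of_real (\<mu> * x)) * zs_beta A g \<mu> x) (at x)"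
    by simp
qed

section \<open>Limits of the explicit solution at both infinities\<close>

lemma zs_t_at_top:
  assumes "A > 0" shows "(zs_t A \<longlongrightarrow> 0) at_top"
proof -
  have "filterlim (\<lambda>x. A * x) at_top at_top"
    using assms by (intro filterlim_tendsto_pos_mult_at_top[OF tendsto_const] filterlim_ident)
  from tendsto_divide[OF tendsto_diff[OF tendsto_const[of 1] filterlim_compose[OF tanh_real_at_top this]] tendsto_const[of 2]]
  show ?thesis by (simp add: zs_t_def[abs_def])
qed

lemma zs_t_at_bot:
  assumes "A > 0" shows "filterlim (zs_t A) (at_left 1) at_bot"
proof -
  have "filterlim (\<lambda>x. A * x) at_bot at_bot"
    using assms by (intro filterlim_tendsto_pos_mult_at_bot[OF tendsto_const] filterlim_ident)
  from tendsto_divide[OF tendsto_diff[OF tendsto_const[of 1] filterlim_compose[OF tanh_real_at_bot this]] tendsto_const[of 2]]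
  have "(zs_t A \<longlongrightarrow> 1) at_bot" by (simp add: zs_t_def[abs_def])
  then show ?thesis
    using zs_t_bounds by (auto simp: filterlim_at intro!: always_eventually less_imp_neq)
qed

lemma hyp2F1_zs_t_at_top:
  assumes "A > 0" "Re c > 0"
  shows "((\<lambda>x. hyp2F1 a b c (of_real (zs_t A x))) \<longlongrightarrow> 1) at_top"
proof -
  have cont: "isCont (hyp2F1 a b c) (of_real 0)"
    using hyp2F1_has_field_derivative[OF not_nonpos_Ints_Re_pos[OF assms(2)], of 0]
    by (intro DERIV_isCont) auto
  have "((\<lambda>x. complex_of_real (zs_t A x)) \<longlongrightarrow> of_real 0) at_top"
    by (intro tendsto_of_real zs_t_at_top assms)
  from isCont_tendsto_compose[OF cont this]
  show ?thesis by (simp add: hyp2F1_def)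
qed

lemma zs_at_top:
  assumes "A > 0"
  shows "(zs_beta A g \<mu> \<longlongrightarrow> 1) at_top" "(zs_alpha A g \<mu> \<longlongrightarrow> 0) at_top"
proof -
  show "(zs_beta A g \<mu> \<longlongrightarrow> 1) at_top"
    unfolding zs_beta_def[abs_def] by (intro hyp2F1_zs_t_at_top assms) simp
  have "((\<lambda>x. exp (2 * \<i> * of_real (\<mu> * x)) / of_real (2 * cosh (A * x))) \<longlongrightarrow> 0) at_top"
  proof (rule Lim_null_comparison)
    show "\<forall>\<^sub>F x in at_top. norm (exp (2 * \<i> * complex_of_real (\<mu> * x)) / of_real (2 * cosh (A * x))) \<le> exp (- (A * x))"
    proof (intro always_eventually allI)
      fix x
      have "exp (A * x) \<le> 2 * cosh (A * x)" by (simp add: cosh_def)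
      then have "1 / (2 * cosh (A * x)) \<le> 1 / exp (A * x)"
        by (intro divide_left_mono) auto
      then show "norm (exp (2 * \<i> * complex_of_real (\<mu> * x)) / of_real (2 * cosh (A * x))) \<le> exp (- (A * x))"
        by (simp add: norm_divide norm_mult exp_minus inverse_eq_divide)
    qed
    have "filterlim (\<lambda>x. A * x) at_top at_top"
      using assms by (intro filterlim_tendsto_pos_mult_at_top[OF tendsto_const] filterlim_ident)
    then have "filterlim (\<lambda>x. - (A * x)) at_bot at_top"
      by (simp add: filterlim_uminus_at_top)
    then show "((\<lambda>x. exp (- (A * x))) \<longlongrightarrow> 0) at_top"
      by (rule filterlim_compose[OF exp_at_bot])
  qed
  then have "(zs_alpha A g \<mu> \<longlongrightarrow> - g / (1/2 - \<i> * of_real (\<mu> / A)) * 0 * 1) at_top"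
    unfolding zs_alpha_def[abs_def]
    by (intro tendsto_mult[OF tendsto_mult[OF tendsto_const] hyp2F1_zs_t_at_top] assms) auto
  then show "(zs_alpha A g \<mu> \<longlongrightarrow> 0) at_top" by simp
qed

text \<open>Here c - a - b = \<open>\<gamma>\<close> has real part 1/2, so Gauss's theorem applies;
  c and c - a - b coincide, hence the square.\<close>

lemma zs_beta_at_bot:
  fixes \<mu> :: real
  assumes "A > 0"
  defines "\<gamma> \<equiv> 1/2 - \<i> * of_real (\<mu> / A)"
  shows "(zs_beta A g \<mu> \<longlongrightarrow> (Gamma \<gamma>)\<^sup>2 / (Gamma (\<gamma> - g) * Gamma (\<gamma> + g))) at_bot"
proof -
  have \<gamma>: "Re \<gamma> > 0" by (simp add: \<gamma>_def)
  have "((\<lambda>t. hyp2F1 g (- g) \<gamma> (of_real t)) \<longlongrightarrow> hyp2F1 g (- g) \<gamma> 1) (at_left 1)"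
    by (rule hyp2F1_tendsto_at_left_1) (use \<gamma> not_nonpos_Ints_Re_pos in auto)
  from filterlim_compose[OF this zs_t_at_bot[OF assms(1)]]
  have "(zs_beta A g \<mu> \<longlongrightarrow> hyp2F1 g (- g) \<gamma> 1) at_bot"
    unfolding zs_beta_def[abs_def] \<gamma>_def .
  also have "hyp2F1 g (- g) \<gamma> 1 = (Gamma \<gamma>)\<^sup>2 / (Gamma (\<gamma> - g) * Gamma (\<gamma> + g))"
    using gauss_summation[of \<gamma> g "- g"] \<gamma>
    by (simp add: rGamma_inverse_Gamma power2_eq_square divide_simps)
  finally show ?thesis .
qed

text \<open>The prefactor of the series is exactly t^gamma (1 - t)^(1 - gamma), and 1 - gamma is the
  exponent a + b - c of its singularity. Two reflection formulas, at gamma and at g, evaluate the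
  remaining Gamma product.\<close>

lemma zs_alpha_at_bot:
  assumes A: "A > 0"
  shows "(zs_alpha A g \<mu> \<longlongrightarrow> - sin (of_real pi * g) / of_real (cosh (pi * \<mu> / A))) at_bot"
proof -
  define \<gamma> where "\<gamma> = 1/2 - \<i> * of_real (\<mu> / A)"
  have \<gamma>: "Re \<gamma> = 1/2" "\<gamma> \<noteq> 0" by (auto simp: \<gamma>_def complex_eq_iff)
  define K where "K = Gamma (\<gamma> + 1) * Gamma (1 - \<gamma>) * rGamma (g + 1) * rGamma (- g + 1)"
  have h: "((\<lambda>t. exp ((1 - \<gamma>) * of_real (ln (1 - t))) * hyp2F1 (g + 1) (- g + 1) (\<gamma> + 1) (of_real t)) \<longlongrightarrow> K) (at_left 1)"
    unfolding K_def by (rule hyp2F1_asymp_at_left_1) (use \<gamma> in \<open>auto intro!: not_nonpos_Ints_Re_pos\<close>)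
  have e: "((\<lambda>t. exp (\<gamma> * of_real (ln t))) \<longlongrightarrow> exp (\<gamma> * of_real (ln 1))) (at_left 1)"
    by (intro tendsto_intros) auto
  from filterlim_compose[OF tendsto_mult[OF tendsto_mult[OF tendsto_const[of "- g / \<gamma>"] e] h] zs_t_at_bot[OF A]]
  have "((\<lambda>x. - g / \<gamma> * exp (\<gamma> * of_real (ln (zs_t A x))) *
      (exp ((1 - \<gamma>) * of_real (ln (1 - zs_t A x))) * hyp2F1 (g + 1) (- g + 1) (\<gamma> + 1) (of_real (zs_t A x))))
      \<longlongrightarrow> - g / \<gamma> * K) at_bot" by simp
  moreover have "- g / \<gamma> * exp (\<gamma> * of_real (ln (zs_t A x))) *
      (exp ((1 - \<gamma>) * of_real (ln (1 - zs_t A x))) * hyp2F1 (g + 1) (- g + 1) (\<gamma> + 1) (of_real (zs_t A x)))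
      = zs_alpha A g \<mu> x" for x
  proof -
    define l where "l = ln (2 * cosh (A * x))"
    have ln1: "ln (zs_t A x) = - (A * x) - l" "ln (1 - zs_t A x) = A * x - l"
      unfolding one_minus_zs_t_eq unfolding zs_t_eq l_def by (simp_all add: ln_div)
    \<comment> \<open>The exponents add up to - l + (1 - 2 gamma) A x, and (1 - 2 gamma) A = 2 i
      mu.\<close>
    have "exp (\<gamma> * of_real (ln (zs_t A x))) * exp ((1 - \<gamma>) * of_real (ln (1 - zs_t A x)))
        = exp (2 * \<i> * of_real (\<mu> * x) - of_real l)"
      unfolding ln1 exp_add[symmetric] using A
      by (intro arg_cong[where f = exp]) (simp add: \<gamma>_def field_simps)
    also have "\<dots> = exp (2 * \<i> * of_real (\<mu> * x)) / of_real (2 * cosh (A * x))"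
      unfolding exp_diff exp_of_real l_def by simp
    finally have E: "exp (\<gamma> * of_real (ln (zs_t A x))) * exp ((1 - \<gamma>) * of_real (ln (1 - zs_t A x)))
        = exp (2 * \<i> * of_real (\<mu> * x)) / of_real (2 * cosh (A * x))" .
    show ?thesis
      unfolding zs_alpha_def \<gamma>_def[symmetric] E[symmetric] by (simp add: mult_ac)
  qed
  ultimately have "(zs_alpha A g \<mu> \<longlongrightarrow> - g / \<gamma> * K) at_bot" by simp
  also have "- g / \<gamma> * K = - sin (of_real pi * g) / of_real (cosh (pi * \<mu> / A))"
  proof -
    have "Gamma (\<gamma> + 1) = \<gamma> * Gamma \<gamma>"
      using \<gamma> by (intro Gamma_plus1 not_nonpos_Ints_Re_pos) simp
    then have "- g / \<gamma> * K = - (Gamma \<gamma> * Gamma (1 - \<gamma>)) * ((g * rGamma (g + 1)) * rGamma (1 - g))"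
      using \<gamma>(2) by (simp add: K_def)
    also have "g * rGamma (g + 1) = rGamma g" by (rule rGamma_plus1)
    also have "rGamma g * rGamma (1 - g) = sin (of_real pi * g) / of_real pi"
      by (rule rGamma_reflection_complex)
    also have "Gamma \<gamma> * Gamma (1 - \<gamma>) = of_real pi / sin (of_real pi * \<gamma>)"
      by (rule Gamma_reflection_complex)
    also have "sin (of_real pi * \<gamma>) = of_real (cosh (pi * \<mu> / A))"
    proof -
      define y where "y = pi * \<mu> / A"
      have "of_real pi * \<gamma> = of_real (pi / 2) - \<i> * of_real y"
        by (simp add: \<gamma>_def y_def field_simps)
      moreover have "cosh (of_real y) = complex_of_real (cosh y)"
        by (simp add: cosh_def scaleR_conv_of_real exp_of_real flip: of_real_minus)
      ultimately show ?thesis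
        unfolding y_def[symmetric] by (simp add: sin_diff flip: cosh_conv_cos)
    qed
    finally show ?thesis by simp
  qed
  finally show ?thesis .
qed

section \<open>Wronskians, uniqueness and the symmetry in mu\<close>

text \<open>The coefficient matrix is off-diagonal, hence of trace zero.\<close>

lemma zs_wronskian_constant:
  assumes "zs_solution A g \<mu> \<alpha> \<beta>" "zs_solution A g \<mu> \<alpha>' \<beta>'"
  obtains w where "\<And>x. \<alpha> x * \<beta>' x - \<beta> x * \<alpha>' x = w"
proof -
  have "((\<lambda>x. \<alpha> x * \<beta>' x - \<beta> x * \<alpha>' x) has_vector_derivative 0) (at x within UNIV)" for x
  proof -
    define p where "p = g * of_real (A / cosh (A * x)) * exp (2 * \<i> * of_real (\<mu> * x))"
    define r where "r = - g * of_real (A / cosh (A * x)) * exp (- 2 * \<i> * of_real (\<mu> * x))"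
    have "((\<lambda>x. \<alpha> x * \<beta>' x - \<beta> x * \<alpha>' x) has_vector_derivative
       (\<alpha> x * (r * \<alpha>' x) + (p * \<beta> x) * \<beta>' x) - (\<beta> x * (p * \<beta>' x) + (r * \<alpha> x) * \<alpha>' x)) (at x)"
      using assms unfolding zs_solution_def p_def r_def
      by (intro has_vector_derivative_diff has_vector_derivative_mult) blast+
    then show ?thesis by (simp add: algebra_simps)
  qed
  from has_vector_derivative_zero_constant[OF convex_UNIV this]
  show thesis using that by auto
qed

text \<open>The data are prescribed at infinity and not at a point, so each constant Wronskian is
  evaluated by its limit there. It is 0 against both members of the fundamental pair, and 1 for the
  pair itself; Cramer's rule then gives the zero solution.\<close>

lemma zs_solution_trivial:
  assumes z: "zs_solution A g \<mu> \<alpha> \<beta>" and l: "(\<alpha> \<longlongrightarrow> 0) at_top" "(\<beta> \<longlongrightarrow> 0) at_top"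
    and z1: "zs_solution A g \<mu> \<alpha>1 \<beta>1" and l1: "(\<alpha>1 \<longlongrightarrow> 1) at_top" "(\<beta>1 \<longlongrightarrow> 0) at_top"
    and z2: "zs_solution A g \<mu> \<alpha>2 \<beta>2" and l2: "(\<alpha>2 \<longlongrightarrow> 0) at_top" "(\<beta>2 \<longlongrightarrow> 1) at_top"
  shows "\<alpha> x = 0" "\<beta> x = 0"
proof -
  have wr: "a x * b' x - b x * a' x = l * m' - m * l'"
    if z: "zs_solution A g \<mu> a b" "zs_solution A g \<mu> a' b'"
      and lims: "(a \<longlongrightarrow> l) at_top" "(b \<longlongrightarrow> m) at_top" "(a' \<longlongrightarrow> l') at_top" "(b' \<longlongrightarrow> m') at_top"
    for a b a' b' l m l' m'
  proof -
    obtain w where w: "\<And>x. a x * b' x - b x * a' x = w"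
      using zs_wronskian_constant[OF z] by blast
    have "((\<lambda>x. a x * b' x - b x * a' x) \<longlongrightarrow> l * m' - m * l') at_top"
      by (intro tendsto_intros lims)
    then have "((\<lambda>x::real. w) \<longlongrightarrow> l * m' - m * l') at_top" unfolding w .
    then have "w = l * m' - m * l'"
      using tendsto_unique[OF _ tendsto_const] by (metis trivial_limit_at_top_linorder)
    then show ?thesis using w by simp
  qed
  have w1: "\<alpha> x * \<beta>1 x = \<beta> x * \<alpha>1 x" using wr[OF z z1 l l1] by simp
  have w2: "\<alpha> x * \<beta>2 x = \<beta> x * \<alpha>2 x" using wr[OF z z2 l l2] by simp
  have w12: "\<alpha>1 x * \<beta>2 x - \<beta>1 x * \<alpha>2 x = 1" using wr[OF z1 z2 l1 l2] by simp
  have "\<alpha> x = \<alpha> x * (\<alpha>1 x * \<beta>2 x - \<beta>1 x * \<alpha>2 x)" by (simp add: w12)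
  also have "\<dots> = \<alpha>1 x * (\<alpha> x * \<beta>2 x) - \<alpha>2 x * (\<alpha> x * \<beta>1 x)" by (simp add: algebra_simps)
  also have "\<dots> = 0" unfolding w1 w2 by (simp add: algebra_simps)
  finally show "\<alpha> x = 0" .
  have "\<beta> x = \<beta> x * (\<alpha>1 x * \<beta>2 x - \<beta>1 x * \<alpha>2 x)" by (simp add: w12)
  also have "\<dots> = \<beta>2 x * (\<beta> x * \<alpha>1 x) - \<beta>1 x * (\<beta> x * \<alpha>2 x)" by (simp add: algebra_simps)
  also have "\<dots> = 0" unfolding w1[symmetric] w2[symmetric] by (simp add: algebra_simps)
  finally show "\<beta> x = 0" .
qed

text \<open>Source of the first column of the Jost matrix: a solution for - mu tending to (0, 1)
  turns into one for mu tending to (1, 0).\<close>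

lemma zs_solution_reflect:
  assumes "zs_solution A g (- \<mu>) \<alpha> \<beta>"
  shows "zs_solution A g \<mu> \<beta> (\<lambda>x. - \<alpha> x)"
  unfolding zs_solution_def
proof (intro allI conjI)
  fix x
  have d: "(\<alpha> has_vector_derivative g * of_real (A / cosh (A * x)) * exp (2 * \<i> * of_real (- \<mu> * x)) * \<beta> x) (at x)"
    "(\<beta> has_vector_derivative - g * of_real (A / cosh (A * x)) * exp (- 2 * \<i> * of_real (- \<mu> * x)) * \<alpha> x) (at x)"
    using assms unfolding zs_solution_def by blast+
  show "(\<beta> has_vector_derivative g * of_real (A / cosh (A * x)) * exp (2 * \<i> * of_real (\<mu> * x)) * - \<alpha> x) (at x)"
    using d(2) by simp
  show "((\<lambda>x. - \<alpha> x) has_vector_derivative - g * of_real (A / cosh (A * x)) * exp (- 2 * \<i> * of_real (\<mu> * x)) * \<beta> x) (at x)"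
    using has_vector_derivative_minus[OF d(1)] by simp
qed

lemma zs_solution_diff:
  assumes "zs_solution A g \<mu> \<alpha> \<beta>" "zs_solution A g \<mu> \<alpha>' \<beta>'"
  shows "zs_solution A g \<mu> (\<lambda>x. \<alpha> x - \<alpha>' x) (\<lambda>x. \<beta> x - \<beta>' x)"
  using assms unfolding zs_solution_def right_diff_distrib
  by (blast intro: has_vector_derivative_diff)

section \<open>Reduction of the Lax equation\<close>

lemma mat2_nth [simp]:
  "mat2 a b c d $ 1 $ 1 = a" "mat2 a b c d $ 1 $ 2 = b"
  "mat2 a b c d $ 2 $ 1 = c" "mat2 a b c d $ 2 $ 2 = d"
  by (simp_all add: mat2_def)

lemma mat2_cases: "M = mat2 (M $ 1 $ 1) (M $ 1 $ 2) (M $ 2 $ 1) (M $ 2 $ 2)"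
  by (simp add: vec_eq_iff forall_2)

lemma mat2_mult:
  "mat2 a b c d ** mat2 a' b' c' d'
     = mat2 (a * a' + b * c') (a * b' + b * d') (c * a' + d * c') (c * b' + d * d')"
  by (simp add: vec_eq_iff forall_2 matrix_matrix_mult_def sum_2)

lemma mat_1_mat2: "mat 1 = mat2 1 0 0 1"
  by (simp add: vec_eq_iff forall_2 mat_def)

lemma tendsto_mat2_iff:
  "((M :: 'a \<Rightarrow> complex^2^2) \<longlongrightarrow> mat2 a b c d) F \<longleftrightarrow>
     ((\<lambda>x. M x $ 1 $ 1) \<longlongrightarrow> a) F \<and> ((\<lambda>x. M x $ 1 $ 2) \<longlongrightarrow> b) F \<and>
     ((\<lambda>x. M x $ 2 $ 1) \<longlongrightarrow> c) F \<and> ((\<lambda>x. M x $ 2 $ 2) \<longlongrightarrow> d) F"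
proof (intro iffI conjI)
  assume "(M \<longlongrightarrow> mat2 a b c d) F"
  then have "((\<lambda>x. M x $ i $ j) \<longlongrightarrow> mat2 a b c d $ i $ j) F" for i j
    by (intro tendsto_vec_nth)
  from this[of 1 1] this[of 1 2] this[of 2 1] this[of 2 2]
  show "((\<lambda>x. M x $ 1 $ 1) \<longlongrightarrow> a) F" "((\<lambda>x. M x $ 1 $ 2) \<longlongrightarrow> b) F"
    "((\<lambda>x. M x $ 2 $ 1) \<longlongrightarrow> c) F" "((\<lambda>x. M x $ 2 $ 2) \<longlongrightarrow> d) F" by simp_all
next
  assume *: "((\<lambda>x. M x $ 1 $ 1) \<longlongrightarrow> a) F \<and> ((\<lambda>x. M x $ 1 $ 2) \<longlongrightarrow> b) F \<and>
     ((\<lambda>x. M x $ 2 $ 1) \<longlongrightarrow> c) F \<and> ((\<lambda>x. M x $ 2 $ 2) \<longlongrightarrow> d) F"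
  have "((\<lambda>x. M x $ i $ j) \<longlongrightarrow> mat2 a b c d $ i $ j) F" for i j
    using * exhaust_2[of i] exhaust_2[of j] by auto
  then show "(M \<longlongrightarrow> mat2 a b c d) F"
    by (intro vec_tendstoI)
qed

lemma has_vector_derivative_vec_iff:
  fixes f :: "real \<Rightarrow> 'a::real_normed_vector^'n"
  shows "(f has_vector_derivative f') (at x) \<longleftrightarrow>
    (\<forall>i. ((\<lambda>x. f x $ i) has_vector_derivative f' $ i) (at x))"
proof
  assume "(f has_vector_derivative f') (at x)"
  then show "\<forall>i. ((\<lambda>x. f x $ i) has_vector_derivative f' $ i) (at x)"
    using bounded_linear.has_vector_derivative[OF bounded_linear_vec_nth] by blast
next
  assume "\<forall>i. ((\<lambda>x. f x $ i) has_vector_derivative f' $ i) (at x)"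
  then show "(f has_vector_derivative f') (at x)"
    unfolding has_vector_derivative_def has_derivative_within
    by (auto intro!: vec_tendstoI bounded_linear_scaleR_left)
qed

lemma has_vector_derivative_mat2_iff:
  "((M :: real \<Rightarrow> complex^2^2) has_vector_derivative mat2 a b c d) (at x) \<longleftrightarrow>
     ((\<lambda>x. M x $ 1 $ 1) has_vector_derivative a) (at x) \<and> ((\<lambda>x. M x $ 1 $ 2) has_vector_derivative b) (at x) \<and>
     ((\<lambda>x. M x $ 2 $ 1) has_vector_derivative c) (at x) \<and> ((\<lambda>x. M x $ 2 $ 2) has_vector_derivative d) (at x)"
  by (simp add: has_vector_derivative_vec_iff forall_2 conj_ac)

text \<open>\<open>matrix_inv\<close> is a choice operator; uniqueness of two-sided inverses pins
  down its value.\<close>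

lemma matrix_inv_eqI:
  fixes A B :: "'a::semiring_1^'n^'n"
  assumes "A ** B = mat 1" "B ** A = mat 1"
  shows "matrix_inv A = B"
proof -
  have "A ** matrix_inv A = mat 1 \<and> matrix_inv A ** A = mat 1"
    unfolding matrix_inv_def by (rule someI[of _ B]) (use assms in simp)
  then show ?thesis
    by (metis assms matrix_mul_assoc matrix_mul_lid matrix_mul_rid)
qed

section \<open>Conjugation of the Lax equation by E\<close>

text \<open>The dispersion relation is stated over the complex numbers because g may be imaginary.
  Positivity of \<open>\<mu>\<close> avoids the branch point, where p^2 = -1 and E is
  singular.\<close>

locale sech_potential =
  fixes A \<mu> k :: real and g c :: complex and q :: "real \<Rightarrow> complex"
  assumes A: "A > 0" and g: "g \<noteq> 0" and c: "c = \<i> * g"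
    and q: "\<And>x. q x = 1 - \<i> * of_real A / of_real (cosh (A * x))"
    and \<mu>: "\<mu> > 0" and \<mu>k: "of_real (\<mu>\<^sup>2) = of_real (k\<^sup>2) + g\<^sup>2" and mu_of: "mu_of c k = \<mu>"
begin

definition p :: complex where
  "p = (of_real \<mu> - of_real k) / g"

text \<open>The first two relations are the rows of the eigenvector equation for the column (1, -p)
  of P with eigenvalue - i mu. They give (1 + p^2)(mu + k) = 2 mu, hence det P = 1 + p^2 is
  nonzero.\<close>

lemma p_relations:
  "\<i> * of_real \<mu> - \<i> * of_real k - \<i> * g * p = 0"
  "p * (of_real \<mu> + of_real k) = g"
  "1 + p\<^sup>2 \<noteq> 0"
proof -
  have gp: "g * p = of_real \<mu> - of_real k"
    using g by (simp add: p_def)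
  show "\<i> * of_real \<mu> - \<i> * of_real k - \<i> * g * p = 0"
    by (simp add: mult.assoc gp algebra_simps)
  have "g\<^sup>2 = (of_real \<mu> - of_real k) * (of_real \<mu> + of_real k)"
    using \<mu>k by (simp add: algebra_simps power2_eq_square)
  then show pg: "p * (of_real \<mu> + of_real k) = g"
    using g by (simp add: p_def power2_eq_square field_simps)
  have "(1 + p\<^sup>2) * (of_real \<mu> + of_real k)
      = of_real \<mu> + of_real k + p * (p * (of_real \<mu> + of_real k))"
    by (simp add: algebra_simps power2_eq_square)
  also note pg
  also have "p * g = of_real \<mu> - of_real k"
    using g by (simp add: p_def)
  finally have "(1 + p\<^sup>2) * (of_real \<mu> + of_real k) = 2 * of_real \<mu>" by simp
  then show "1 + p\<^sup>2 \<noteq> 0" using \<mu> by auto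
qed

definition E_inv :: "real \<Rightarrow> complex^2^2" where
  "E_inv x = mat2 (exp (\<i> * of_real (\<mu> * x)) / (1 + p\<^sup>2)) (- p * exp (\<i> * of_real (\<mu> * x)) / (1 + p\<^sup>2))
     (p * exp (- \<i> * of_real (\<mu> * x)) / (1 + p\<^sup>2)) (exp (- \<i> * of_real (\<mu> * x)) / (1 + p\<^sup>2))"

lemma E_matrix_eq:
  "E_matrix c k x = mat2 (exp (- \<i> * of_real (\<mu> * x))) (p * exp (\<i> * of_real (\<mu> * x)))
     (- p * exp (- \<i> * of_real (\<mu> * x))) (exp (\<i> * of_real (\<mu> * x)))"
proof -
  have "g_of c = g" by (simp add: g_of_def c)
  then show ?thesis
    by (simp add: E_matrix_def P_matrix_def mu_of mat2_mult p_def)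
qed

lemma exp_i_cancel: "exp (\<i> * of_real y) * exp (- \<i> * of_real y) = 1" 
  by (simp flip: exp_add)

lemma E_matrix_E_inv: "E_matrix c k x ** E_inv x = mat 1" "E_inv x ** E_matrix c k x = mat 1"
proof -
  define u v where "u = exp (\<i> * of_real (\<mu> * x))" and "v = exp (- \<i> * of_real (\<mu> * x))"
  have uv: "u * v = 1" unfolding u_def v_def by (rule exp_i_cancel)
  define d where "d = 1 / (1 + p\<^sup>2)"
  have d: "d + p * p * d = 1"
    using p_relations(3) by (simp add: d_def power2_eq_square add_divide_distrib[symmetric])
  have Ei: "E_inv x = mat2 (u * d) (- p * u * d) (p * v * d) (v * d)"
    by (simp add: E_inv_def u_def v_def d_def)
  have E: "E_matrix c k x = mat2 v (p * u) (- p * v) u"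
    by (simp add: E_matrix_eq u_def v_def)
  have "v * (u * d) + p * u * (p * v * d) = (u * v) * (d + p * p * d)"
    "v * (- p * u * d) + p * u * (v * d) = 0"
    "- p * v * (u * d) + u * (p * v * d) = 0"
    "- p * v * (- p * u * d) + u * (v * d) = (u * v) * (d + p * p * d)"
    by (simp_all add: algebra_simps)
  then show "E_matrix c k x ** E_inv x = mat 1"
    unfolding E Ei mat2_mult mat_1_mat2 uv d by simp
  have "u * d * v + - p * u * d * (- p * v) = (u * v) * (d + p * p * d)"
    "u * d * (p * u) + - p * u * d * u = 0"
    "p * v * d * v + v * d * (- p * v) = 0"
    "p * v * d * (p * u) + v * d * u = (u * v) * (d + p * p * d)"
    by (simp_all add: algebra_simps)
  then show "E_inv x ** E_matrix c k x = mat 1"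
    unfolding E Ei mat2_mult mat_1_mat2 uv d by simp
qed

lemma matrix_inv_E: "matrix_inv (E_matrix c k x) = E_inv x"
  by (rule matrix_inv_eqI) (rule E_matrix_E_inv)+

text \<open>q - 1 is purely imaginary, so conjugation flips its sign; that is why the x-dependent
  part is antisymmetric.\<close>

lemma lax_matrix_eq:
  "lax_matrix q c k x =
     mat2 (- \<i> * of_real k) (\<i> * g + g * of_real (A / cosh (A * x)))
       (\<i> * g - g * of_real (A / cosh (A * x))) (\<i> * of_real k)"
proof -
  have M: "mat (- \<i> * of_real k) = mat2 (- \<i> * of_real k) 0 0 (- \<i> * of_real k)"
    by (simp add: vec_eq_iff forall_2 mat_def)
  then show ?thesis
    unfolding lax_matrix_def W_potential_def sigma3_def M mat2_mult q c
    by (simp add: vec_eq_iff forall_2 algebra_simps)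
qed

definition lax_column :: "(real \<Rightarrow> complex) \<Rightarrow> (real \<Rightarrow> complex) \<Rightarrow> bool" where
  "lax_column \<phi> \<psi> \<longleftrightarrow> (\<forall>x.
     (\<phi> has_vector_derivative - \<i> * of_real k * \<phi> x + (\<i> * g + g * of_real (A / cosh (A * x))) * \<psi> x) (at x) \<and>
     (\<psi> has_vector_derivative (\<i> * g - g * of_real (A / cosh (A * x))) * \<phi> x + \<i> * of_real k * \<psi> x) (at x))"

lemma lax_equation_iff:
  fixes \<Psi> :: "real \<Rightarrow> complex^2^2"
  shows "(\<forall>x. (\<Psi> has_vector_derivative (lax_matrix q c k x ** \<Psi> x)) (at x)) \<longleftrightarrow>
     lax_column (\<lambda>x. \<Psi> x $ 1 $ 1) (\<lambda>x. \<Psi> x $ 2 $ 1) \<and>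
     lax_column (\<lambda>x. \<Psi> x $ 1 $ 2) (\<lambda>x. \<Psi> x $ 2 $ 2)"
proof -
  have L: "lax_matrix q c k x ** \<Psi> x = 
    mat2 (- \<i> * of_real k * \<Psi> x $ 1 $ 1 + (\<i> * g + g * of_real (A / cosh (A * x))) * \<Psi> x $ 2 $ 1)
     (- \<i> * of_real k * \<Psi> x $ 1 $ 2 + (\<i> * g + g * of_real (A / cosh (A * x))) * \<Psi> x $ 2 $ 2)
     ((\<i> * g - g * of_real (A / cosh (A * x))) * \<Psi> x $ 1 $ 1 + \<i> * of_real k * \<Psi> x $ 2 $ 1)
     ((\<i> * g - g * of_real (A / cosh (A * x))) * \<Psi> x $ 1 $ 2 + \<i> * of_real k * \<Psi> x $ 2 $ 2)" for x
    by (subst mat2_cases[of "\<Psi> x"]) (simp only: lax_matrix_eq mat2_mult)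
  show ?thesis
    unfolding L has_vector_derivative_mat2_iff lax_column_def by blast
qed

text \<open>The two functions are a column of E^{-1} Psi. This direction serves uniqueness; its
  converse \<open>zs_imp_lax_column\<close> serves existence.\<close>

lemma lax_column_imp_zs:
  assumes "lax_column \<phi> \<psi>"
  shows "zs_solution A g \<mu>
    (\<lambda>x. exp (\<i> * of_real (\<mu> * x)) * (1 / (1 + p\<^sup>2) * (\<phi> x - p * \<psi> x)))
    (\<lambda>x. exp (- \<i> * of_real (\<mu> * x)) * (1 / (1 + p\<^sup>2) * (p * \<phi> x + \<psi> x)))"
  unfolding zs_solution_def
proof (intro allI conjI)
  fix x
  define w where "w = g * of_real (A / cosh (A * x))"
  define u v where "u = exp (\<i> * of_real (\<mu> * x))" and "v = exp (- \<i> * of_real (\<mu> * x))"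
  have uv: "u * v = 1" "v * u = 1"
    using exp_i_cancel[of "\<mu> * x"] by (auto simp: u_def v_def mult.commute)
  have u2: "exp (2 * \<i> * of_real (\<mu> * x)) = u * u" "exp (- 2 * \<i> * of_real (\<mu> * x)) = v * v"
    by (simp_all add: u_def v_def mult_ac flip: exp_add)
  define d where "d = 1 / (1 + p\<^sup>2)"
  have d: "(\<phi> has_vector_derivative - \<i> * of_real k * \<phi> x + (\<i> * g + w) * \<psi> x) (at x)"
    "(\<psi> has_vector_derivative (\<i> * g - w) * \<phi> x + \<i> * of_real k * \<psi> x) (at x)"
    using assms unfolding lax_column_def w_def by blast+
  have ed: "((\<lambda>x. exp (\<i> * of_real (\<mu> * x))) has_vector_derivative \<i> * of_real \<mu> * u) (at x)"
    "((\<lambda>x. exp (- \<i> * of_real (\<mu> * x))) has_vector_derivative - \<i> * of_real \<mu> * v) (at x)"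
    unfolding u_def v_def by (rule exp_i_has_vector_derivative)+
  have "((\<lambda>x. exp (\<i> * of_real (\<mu> * x)) * (d * (\<phi> x - p * \<psi> x))) has_vector_derivative
     u * (d * ((- \<i> * of_real k * \<phi> x + (\<i> * g + w) * \<psi> x) - p * ((\<i> * g - w) * \<phi> x + \<i> * of_real k * \<psi> x)))
     + \<i> * of_real \<mu> * u * (d * (\<phi> x - p * \<psi> x))) (at x)"
    unfolding u_def
    by (intro has_vector_derivative_mult has_vector_derivative_mult_right has_vector_derivative_diff
        d ed(1)[unfolded u_def])
  moreover have "u * (d * ((- \<i> * of_real k * \<phi> x + (\<i> * g + w) * \<psi> x) - p * ((\<i> * g - w) * \<phi> x + \<i> * of_real k * \<psi> x)))
     + \<i> * of_real \<mu> * u * (d * (\<phi> x - p * \<psi> x))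
     = w * (u * u) * (v * (d * (p * \<phi> x + \<psi> x)))"
  proof -
    \<comment> \<open>The terms are grouped so that \<open>p_relations\<close> removes the constant
      part of the Lax matrix and only the w-term is left.\<close>
    have "(- \<i> * of_real k * \<phi> x + (\<i> * g + w) * \<psi> x) - p * ((\<i> * g - w) * \<phi> x + \<i> * of_real k * \<psi> x)
       + \<i> * of_real \<mu> * (\<phi> x - p * \<psi> x)
      = (\<i> * of_real \<mu> - \<i> * of_real k - \<i> * g * p) * \<phi> x
        + \<i> * (g - p * (of_real \<mu> + of_real k)) * \<psi> x + w * (p * \<phi> x + \<psi> x)"
      by (simp add: algebra_simps)
    then have main: "(- \<i> * of_real k * \<phi> x + (\<i> * g + w) * \<psi> x) - p * ((\<i> * g - w) * \<phi> x + \<i> * of_real k * \<psi> x)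
       + \<i> * of_real \<mu> * (\<phi> x - p * \<psi> x) = w * (p * \<phi> x + \<psi> x)"
      unfolding p_relations(1,2) by simp
    have "u * (d * ((- \<i> * of_real k * \<phi> x + (\<i> * g + w) * \<psi> x) - p * ((\<i> * g - w) * \<phi> x + \<i> * of_real k * \<psi> x)))
     + \<i> * of_real \<mu> * u * (d * (\<phi> x - p * \<psi> x))
     = u * d * ((- \<i> * of_real k * \<phi> x + (\<i> * g + w) * \<psi> x) - p * ((\<i> * g - w) * \<phi> x + \<i> * of_real k * \<psi> x)
       + \<i> * of_real \<mu> * (\<phi> x - p * \<psi> x))"
      by (simp only: distrib_left mult_ac)
    \<comment> \<open>The factor u v = 1 is inserted to produce the phase u^2 of the system together
      with the v of the second component.\<close>
    also have "\<dots> = (u * v) * (u * d * (w * (p * \<phi> x + \<psi> x)))"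
      unfolding main uv by simp
    also have "\<dots> = w * (u * u) * (v * (d * (p * \<phi> x + \<psi> x)))"
      by (simp only: mult_ac)
    finally show ?thesis .
  qed
  ultimately show "((\<lambda>x. exp (\<i> * of_real (\<mu> * x)) * (1 / (1 + p\<^sup>2) * (\<phi> x - p * \<psi> x))) has_vector_derivative
      g * of_real (A / cosh (A * x)) * exp (2 * \<i> * of_real (\<mu> * x)) *
      (exp (- \<i> * of_real (\<mu> * x)) * (1 / (1 + p\<^sup>2) * (p * \<phi> x + \<psi> x)))) (at x)"
    unfolding u2 w_def[symmetric] d_def[symmetric] v_def[symmetric] by simp
  have "((\<lambda>x. exp (- \<i> * of_real (\<mu> * x)) * (d * (p * \<phi> x + \<psi> x))) has_vector_derivative
     v * (d * (p * (- \<i> * of_real k * \<phi> x + (\<i> * g + w) * \<psi> x) + ((\<i> * g - w) * \<phi> x + \<i> * of_real k * \<psi> x)))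
     + - \<i> * of_real \<mu> * v * (d * (p * \<phi> x + \<psi> x))) (at x)"
    unfolding v_def
    by (intro has_vector_derivative_mult has_vector_derivative_mult_right has_vector_derivative_add
        d ed(2)[unfolded v_def])
  moreover have "v * (d * (p * (- \<i> * of_real k * \<phi> x + (\<i> * g + w) * \<psi> x) + ((\<i> * g - w) * \<phi> x + \<i> * of_real k * \<psi> x)))
     + - \<i> * of_real \<mu> * v * (d * (p * \<phi> x + \<psi> x))
     = - w * (v * v) * (u * (d * (\<phi> x - p * \<psi> x)))"
  proof -
    have "p * (- \<i> * of_real k * \<phi> x + (\<i> * g + w) * \<psi> x) + ((\<i> * g - w) * \<phi> x + \<i> * of_real k * \<psi> x)
       + - \<i> * of_real \<mu> * (p * \<phi> x + \<psi> x)
      = - ((\<i> * of_real \<mu> - \<i> * of_real k - \<i> * g * p) * \<psi> x)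
        + \<i> * (g - p * (of_real \<mu> + of_real k)) * \<phi> x - w * (\<phi> x - p * \<psi> x)"
      by (simp add: algebra_simps)
    then have main: "p * (- \<i> * of_real k * \<phi> x + (\<i> * g + w) * \<psi> x) + ((\<i> * g - w) * \<phi> x + \<i> * of_real k * \<psi> x)
       + - \<i> * of_real \<mu> * (p * \<phi> x + \<psi> x) = - w * (\<phi> x - p * \<psi> x)"
      unfolding p_relations(1,2) by simp
    have "v * (d * (p * (- \<i> * of_real k * \<phi> x + (\<i> * g + w) * \<psi> x) + ((\<i> * g - w) * \<phi> x + \<i> * of_real k * \<psi> x)))
     + - \<i> * of_real \<mu> * v * (d * (p * \<phi> x + \<psi> x))
     = v * d * (p * (- \<i> * of_real k * \<phi> x + (\<i> * g + w) * \<psi> x) + ((\<i> * g - w) * \<phi> x + \<i> * of_real k * \<psi> x)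
       + - \<i> * of_real \<mu> * (p * \<phi> x + \<psi> x))"
      by (simp only: distrib_left mult_ac)
    also have "\<dots> = (u * v) * (v * d * (- w * (\<phi> x - p * \<psi> x)))"
      unfolding main uv by simp
    also have "\<dots> = - w * (v * v) * (u * (d * (\<phi> x - p * \<psi> x)))"
      by (simp only: mult_ac)
    finally show ?thesis .
  qed
  ultimately show "((\<lambda>x. exp (- \<i> * of_real (\<mu> * x)) * (1 / (1 + p\<^sup>2) * (p * \<phi> x + \<psi> x))) has_vector_derivative
      - g * of_real (A / cosh (A * x)) * exp (- 2 * \<i> * of_real (\<mu> * x)) *
      (exp (\<i> * of_real (\<mu> * x)) * (1 / (1 + p\<^sup>2) * (\<phi> x - p * \<psi> x)))) (at x)"
    unfolding u2 d_def[symmetric] u_def[symmetric] by (simp add: w_def)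
qed

lemma zs_imp_lax_column:
  assumes "zs_solution A g \<mu> \<alpha> \<beta>"
  shows "lax_column
    (\<lambda>x. exp (- \<i> * of_real (\<mu> * x)) * \<alpha> x + p * (exp (\<i> * of_real (\<mu> * x)) * \<beta> x))
    (\<lambda>x. - p * (exp (- \<i> * of_real (\<mu> * x)) * \<alpha> x) + exp (\<i> * of_real (\<mu> * x)) * \<beta> x)"
  unfolding lax_column_def
proof (intro allI)
  fix x
  define w where "w = g * of_real (A / cosh (A * x))"
  define u v where "u = exp (\<i> * of_real (\<mu> * x))" and "v = exp (- \<i> * of_real (\<mu> * x))"
  have uv: "v * (u * u) = u" "u * (v * v) = v"
  proof -
    have "u * v = 1" unfolding u_def v_def by (rule exp_i_cancel)
    moreover have "v * (u * u) = (u * v) * u" "u * (v * v) = (u * v) * v"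
      by (simp_all only: mult_ac)
    ultimately show "v * (u * u) = u" "u * (v * v) = v" by simp_all
  qed
  have u2: "exp (2 * \<i> * of_real (\<mu> * x)) = u * u" "exp (- 2 * \<i> * of_real (\<mu> * x)) = v * v"
    by (simp_all add: u_def v_def mult_ac flip: exp_add)
  have d: "(\<alpha> has_vector_derivative w * (u * u) * \<beta> x) (at x)"
    "(\<beta> has_vector_derivative - w * (v * v) * \<alpha> x) (at x)"
    using assms[unfolded zs_solution_def, rule_format, of x] unfolding w_def u2[symmetric] by simp_all
  have ed: "((\<lambda>x. exp (\<i> * of_real (\<mu> * x))) has_vector_derivative \<i> * of_real \<mu> * u) (at x)"
    "((\<lambda>x. exp (- \<i> * of_real (\<mu> * x))) has_vector_derivative - \<i> * of_real \<mu> * v) (at x)"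
    unfolding u_def v_def by (rule exp_i_has_vector_derivative)+
  have d1: "((\<lambda>x. exp (- \<i> * of_real (\<mu> * x)) * \<alpha> x) has_vector_derivative
      w * (u * \<beta> x) - \<i> * of_real \<mu> * (v * \<alpha> x)) (at x)" (is "(?f has_vector_derivative _) _")
  proof -
    have "(?f has_vector_derivative v * (w * (u * u) * \<beta> x) + - \<i> * of_real \<mu> * v * \<alpha> x) (at x)"
      unfolding v_def by (intro has_vector_derivative_mult d ed(2)[unfolded v_def])
    also have "v * (w * (u * u) * \<beta> x) + - \<i> * of_real \<mu> * v * \<alpha> x
      = w * ((v * (u * u)) * \<beta> x) - \<i> * of_real \<mu> * (v * \<alpha> x)" by (simp add: mult_ac)
    finally show ?thesis unfolding uv .
  qed
  have d2: "((\<lambda>x. exp (\<i> * of_real (\<mu> * x)) * \<beta> x) has_vector_derivative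
      \<i> * of_real \<mu> * (u * \<beta> x) - w * (v * \<alpha> x)) (at x)" (is "(?f has_vector_derivative _) _")
  proof -
    have "(?f has_vector_derivative u * (- w * (v * v) * \<alpha> x) + \<i> * of_real \<mu> * u * \<beta> x) (at x)"
      unfolding u_def by (intro has_vector_derivative_mult d ed(1)[unfolded u_def])
    also have "u * (- w * (v * v) * \<alpha> x) + \<i> * of_real \<mu> * u * \<beta> x
      = \<i> * of_real \<mu> * (u * \<beta> x) - w * ((u * (v * v)) * \<alpha> x)" by (simp add: mult_ac)
    finally show ?thesis unfolding uv .
  qed
  have rel: "\<i> * of_real \<mu> = \<i> * of_real k + \<i> * g * p"
    using p_relations(1) by (simp add: algebra_simps)
  define a b where "a = v * \<alpha> x" and "b = u * \<beta> x"
  \<comment> \<open>\<open>pb\<close> and \<open>mb\<close> trade mu for k and g through mu p = g -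
    k p and mu = k + g p.\<close>
  have pb: "\<i> * of_real \<mu> * (p * z) = \<i> * g * z - \<i> * of_real k * (p * z)" for z
  proof -
    have "\<i> * (p * (of_real \<mu> + of_real k)) * z = \<i> * g * z" unfolding p_relations(2) ..
    then show ?thesis by (simp add: algebra_simps)
  qed
  have mb: "\<i> * of_real \<mu> * z = \<i> * of_real k * z + \<i> * g * (p * z)" for z
    by (subst rel) (simp add: algebra_simps)
  have "w * b - \<i> * of_real \<mu> * a + p * (\<i> * of_real \<mu> * b - w * a)
     = w * b - \<i> * of_real \<mu> * a + (\<i> * of_real \<mu> * (p * b) - p * w * a)" by (simp add: algebra_simps)
  also have "\<dots> = - \<i> * of_real k * (a + p * b) + (\<i> * g + w) * (- p * a + b)"
    unfolding mb[of a] pb by (simp add: algebra_simps)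
  finally have e1: "w * b - \<i> * of_real \<mu> * a + p * (\<i> * of_real \<mu> * b - w * a) = \<dots>" .
  have "- p * (w * b - \<i> * of_real \<mu> * a) + (\<i> * of_real \<mu> * b - w * a)
     = - p * w * b + \<i> * of_real \<mu> * (p * a) + (\<i> * of_real \<mu> * b - w * a)" by (simp add: algebra_simps)
  also have "\<dots> = (\<i> * g - w) * (a + p * b) + \<i> * of_real k * (- p * a + b)"
    unfolding mb[of b] pb by (simp add: algebra_simps)
  finally have e2: "- p * (w * b - \<i> * of_real \<mu> * a) + (\<i> * of_real \<mu> * b - w * a) = \<dots>" .
  show "((\<lambda>x. exp (- \<i> * of_real (\<mu> * x)) * \<alpha> x + p * (exp (\<i> * of_real (\<mu> * x)) * \<beta> x)) has_vector_derivative
      - \<i> * of_real k * (exp (- \<i> * of_real (\<mu> * x)) * \<alpha> x + p * (exp (\<i> * of_real (\<mu> * x)) * \<beta> x)) +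
      (\<i> * g + g * of_real (A / cosh (A * x))) *
      (- p * (exp (- \<i> * of_real (\<mu> * x)) * \<alpha> x) + exp (\<i> * of_real (\<mu> * x)) * \<beta> x)) (at x) \<and>
    ((\<lambda>x. - p * (exp (- \<i> * of_real (\<mu> * x)) * \<alpha> x) + exp (\<i> * of_real (\<mu> * x)) * \<beta> x) has_vector_derivative
      (\<i> * g - g * of_real (A / cosh (A * x))) *
      (exp (- \<i> * of_real (\<mu> * x)) * \<alpha> x + p * (exp (\<i> * of_real (\<mu> * x)) * \<beta> x)) +
      \<i> * of_real k * (- p * (exp (- \<i> * of_real (\<mu> * x)) * \<alpha> x) + exp (\<i> * of_real (\<mu> * x)) * \<beta> x)) (at x)"
    unfolding u_def[symmetric] v_def[symmetric] w_def[symmetric] a_def[symmetric] b_def[symmetric]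
      e1[symmetric] e2[symmetric]
    unfolding a_def b_def
    by (intro conjI has_vector_derivative_add has_vector_derivative_mult_right d1 d2)
qed

text \<open>The entries are bracketed literally as in \<open>lax_column_imp_zs\<close>, so that they
  match by rewriting.\<close>

lemma E_inv_mult:
  fixes M :: "complex^2^2"
  shows "E_inv x ** M = mat2
    (exp (\<i> * of_real (\<mu> * x)) * (1 / (1 + p\<^sup>2) * (M $ 1 $ 1 - p * M $ 2 $ 1)))
    (exp (\<i> * of_real (\<mu> * x)) * (1 / (1 + p\<^sup>2) * (M $ 1 $ 2 - p * M $ 2 $ 2)))
    (exp (- \<i> * of_real (\<mu> * x)) * (1 / (1 + p\<^sup>2) * (p * M $ 1 $ 1 + M $ 2 $ 1)))
    (exp (- \<i> * of_real (\<mu> * x)) * (1 / (1 + p\<^sup>2) * (p * M $ 1 $ 2 + M $ 2 $ 2)))"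
  by (subst mat2_cases[of M], unfold E_inv_def mat2_mult)
    (simp add: algebra_simps add_divide_distrib diff_divide_distrib)

lemma E_matrix_mult:
  fixes N :: "complex^2^2"
  shows "E_matrix c k x ** N = mat2
    (exp (- \<i> * of_real (\<mu> * x)) * N $ 1 $ 1 + p * (exp (\<i> * of_real (\<mu> * x)) * N $ 2 $ 1))
    (exp (- \<i> * of_real (\<mu> * x)) * N $ 1 $ 2 + p * (exp (\<i> * of_real (\<mu> * x)) * N $ 2 $ 2))
    (- p * (exp (- \<i> * of_real (\<mu> * x)) * N $ 1 $ 1) + exp (\<i> * of_real (\<mu> * x)) * N $ 2 $ 1)
    (- p * (exp (- \<i> * of_real (\<mu> * x)) * N $ 1 $ 2) + exp (\<i> * of_real (\<mu> * x)) * N $ 2 $ 2)"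
  by (subst mat2_cases[of N], unfold E_matrix_eq mat2_mult) (simp add: mult.assoc)

section \<open>The Jost solution and its limit at minus infinity\<close>

definition zs_jost :: "(real \<Rightarrow> complex^2^2) \<Rightarrow> bool" where
  "zs_jost N \<longleftrightarrow> zs_solution A g \<mu> (\<lambda>x. N x $ 1 $ 1) (\<lambda>x. N x $ 2 $ 1) \<and>
     zs_solution A g \<mu> (\<lambda>x. N x $ 1 $ 2) (\<lambda>x. N x $ 2 $ 2) \<and> (N \<longlongrightarrow> mat 1) at_top"

lemma is_jost_imp_zs_jost:
  assumes "is_jost_solution q c k \<Psi>"
  shows "zs_jost (\<lambda>x. E_inv x ** \<Psi> x)"
proof -
  from assms have l: "lax_column (\<lambda>x. \<Psi> x $ 1 $ 1) (\<lambda>x. \<Psi> x $ 2 $ 1)"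
     "lax_column (\<lambda>x. \<Psi> x $ 1 $ 2) (\<lambda>x. \<Psi> x $ 2 $ 2)"
    and lim: "((\<lambda>x. E_inv x ** \<Psi> x) \<longlongrightarrow> mat 1) at_top"
    unfolding is_jost_solution_def lax_equation_iff matrix_inv_E by blast+
  show ?thesis
    unfolding zs_jost_def using lax_column_imp_zs[OF l(1)] lax_column_imp_zs[OF l(2)] lim
    by (simp add: E_inv_mult)
qed

lemma zs_jost_imp_is_jost:
  assumes "zs_jost N"
  shows "is_jost_solution q c k (\<lambda>x. E_matrix c k x ** N x)"
proof -
  have "E_inv x ** (E_matrix c k x ** N x) = N x" for x
    by (simp add: matrix_mul_assoc E_matrix_E_inv)
  moreover have "lax_column (\<lambda>x. (E_matrix c k x ** N x) $ 1 $ 1) (\<lambda>x. (E_matrix c k x ** N x) $ 2 $ 1)"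
      "lax_column (\<lambda>x. (E_matrix c k x ** N x) $ 1 $ 2) (\<lambda>x. (E_matrix c k x ** N x) $ 2 $ 2)"
    unfolding E_matrix_mult mat2_nth
    by (rule zs_imp_lax_column; use assms in \<open>simp add: zs_jost_def\<close>)+
  ultimately show ?thesis
    using assms unfolding is_jost_solution_def lax_equation_iff matrix_inv_E zs_jost_def by simp
qed

lemma zs_jost_unique:
  assumes N: "zs_jost N" and N': "zs_jost N'"
  shows "N = N'"
proof
  fix x
  have z: "zs_solution A g \<mu> (\<lambda>x. M x $ 1 $ 1) (\<lambda>x. M x $ 2 $ 1)"
     "zs_solution A g \<mu> (\<lambda>x. M x $ 1 $ 2) (\<lambda>x. M x $ 2 $ 2)"
     "((\<lambda>x. M x $ 1 $ 1) \<longlongrightarrow> 1) at_top" "((\<lambda>x. M x $ 1 $ 2) \<longlongrightarrow> 0) at_top"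
     "((\<lambda>x. M x $ 2 $ 1) \<longlongrightarrow> 0) at_top" "((\<lambda>x. M x $ 2 $ 2) \<longlongrightarrow> 1) at_top" if "zs_jost M" for M
    using that unfolding zs_jost_def mat_1_mat2 tendsto_mat2_iff by auto
  note zN = z[OF N] and zN' = z[OF N']
  have lims: "((\<lambda>x. N x $ 1 $ 1 - N' x $ 1 $ 1) \<longlongrightarrow> 0) at_top" "((\<lambda>x. N x $ 2 $ 1 - N' x $ 2 $ 1) \<longlongrightarrow> 0) at_top"
    "((\<lambda>x. N x $ 1 $ 2 - N' x $ 1 $ 2) \<longlongrightarrow> 0) at_top" "((\<lambda>x. N x $ 2 $ 2 - N' x $ 2 $ 2) \<longlongrightarrow> 0) at_top"
    using tendsto_diff[OF zN(3) zN'(3)] tendsto_diff[OF zN(4) zN'(4)]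
      tendsto_diff[OF zN(5) zN'(5)] tendsto_diff[OF zN(6) zN'(6)] by simp_all
  \<comment> \<open>The columns of \<open>N\<close> itself serve as the fundamental pair; the lemma
    is applied to the columns of the difference.\<close>
  note triv = zs_solution_trivial[OF _ _ _ zN(1) zN(3) zN(5) zN(2) zN(4) zN(6)]
  show "N x = N' x"
    using triv[OF zs_solution_diff[OF zN(1) zN'(1)] lims(1,2), of x]
      triv[OF zs_solution_diff[OF zN(2) zN'(2)] lims(3,4), of x]
    by (simp add: vec_eq_iff forall_2)
qed

definition jost_N :: "real \<Rightarrow> complex^2^2" where
  "jost_N x = mat2 (zs_beta A g (- \<mu>) x) (zs_alpha A g \<mu> x) (- zs_alpha A g (- \<mu>) x) (zs_beta A g \<mu> x)"

lemma zs_jost_N: "zs_jost jost_N"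
proof -
  have "zs_solution A g \<mu> (zs_beta A g (- \<mu>)) (\<lambda>x. - zs_alpha A g (- \<mu>) x)"
    using A by (intro zs_solution_reflect zs_solution_zs) simp
  moreover have "zs_solution A g \<mu> (zs_alpha A g \<mu>) (zs_beta A g \<mu>)"
    using A by (intro zs_solution_zs) simp
  moreover have "((\<lambda>x. - zs_alpha A g (- \<mu>) x) \<longlongrightarrow> 0) at_top"
    using tendsto_minus[OF zs_at_top(2)[OF A, of g "- \<mu>"]] by simp
  ultimately show ?thesis
    unfolding zs_jost_def mat_1_mat2 tendsto_mat2_iff jost_N_def mat2_nth
    using zs_at_top[OF A] by auto
qed

lemma ex1_jost: "\<exists>!\<Psi>. is_jost_solution q c k \<Psi>"
  and jost_solution_eq: "jost_solution q c k = (\<lambda>x. E_matrix c k x ** jost_N x)"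
proof -
  have J: "is_jost_solution q c k (\<lambda>x. E_matrix c k x ** jost_N x)"
    by (rule zs_jost_imp_is_jost[OF zs_jost_N])
  have U: "\<Psi> = (\<lambda>x. E_matrix c k x ** jost_N x)" if "is_jost_solution q c k \<Psi>" for \<Psi>
  proof
    fix x
    have "(\<lambda>x. E_inv x ** \<Psi> x) = jost_N"
      by (rule zs_jost_unique[OF is_jost_imp_zs_jost[OF that] zs_jost_N])
    then have "E_inv x ** \<Psi> x = jost_N x" by metis
    then have "E_matrix c k x ** (E_inv x ** \<Psi> x) = E_matrix c k x ** jost_N x" by simp
    then show "\<Psi> x = E_matrix c k x ** jost_N x" by (simp add: matrix_mul_assoc E_matrix_E_inv)
  qed
  show "\<exists>!\<Psi>. is_jost_solution q c k \<Psi>" using J U by blast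
  show "jost_solution q c k = (\<lambda>x. E_matrix c k x ** jost_N x)"
    unfolding jost_solution_def using J U by (rule the_equality)
qed

text \<open>E^{-1} Psi is \<open>jost_N\<close> exactly, so its entries have the limits already
  computed. The first column is included because the scattering matrix is a limit of whole
  matrices.\<close>

lemma scattering_limit:
  obtains s11 s21 where "((\<lambda>x. matrix_inv (E_matrix c k x) ** jost_solution q c k x) \<longlongrightarrow>
    mat2 s11 (- sin (of_real pi * g) / of_real (cosh (pi * \<mu> / A))) s21
     ((Gamma (1/2 - \<i> * of_real (\<mu> / A)))\<^sup>2 /
       (Gamma (1/2 - \<i> * of_real (\<mu> / A) - g) * Gamma (1/2 - \<i> * of_real (\<mu> / A) + g)))) at_bot"
proof -
  have "matrix_inv (E_matrix c k x) ** jost_solution q c k x = jost_N x" for x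
    unfolding matrix_inv_E jost_solution_eq by (simp add: matrix_mul_assoc E_matrix_E_inv)
  moreover have "(jost_N \<longlongrightarrow> mat2
     ((Gamma (1/2 - \<i> * of_real (- \<mu> / A)))\<^sup>2 /
       (Gamma (1/2 - \<i> * of_real (- \<mu> / A) - g) * Gamma (1/2 - \<i> * of_real (- \<mu> / A) + g)))
     (- sin (of_real pi * g) / of_real (cosh (pi * \<mu> / A)))
     (- (- sin (of_real pi * g) / of_real (cosh (pi * (- \<mu>) / A))))
     ((Gamma (1/2 - \<i> * of_real (\<mu> / A)))\<^sup>2 /
       (Gamma (1/2 - \<i> * of_real (\<mu> / A) - g) * Gamma (1/2 - \<i> * of_real (\<mu> / A) + g)))) at_bot"
    unfolding tendsto_mat2_iff jost_N_def mat2_nth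
    by (intro conjI tendsto_minus zs_beta_at_bot zs_alpha_at_bot A)
  ultimately show thesis using that by simp
qed

end

text \<open>Unique existence and convergence are part of the conclusion because the values of
  \<open>THE\<close> and \<open>Lim\<close> carry information only under these conditions.\<close>

theorem mainTheorem3:
  fixes Z A k \<mu> :: real and c g :: complex and q :: "real \<Rightarrow> complex"
  assumes "Z > 1"
    and "A = Z - 1 / Z"
    and "\<And>x. q x = 1 - \<i> * of_real A / of_real (cosh (A * x))"
    and "c \<in> {\<i> * of_real s | s :: real. s > 0} \<union> {of_real s | s :: real. s > 0}"
    and "c = \<i> * g"
    and "k^2 + Re (g^2) > 0"
    and "\<mu> = sqrt (k^2 + Re (g^2))"
  shows "(\<exists>!\<Psi>. is_jost_solution q c k \<Psi>) \<and>
    (\<exists>S. ((\<lambda>x. matrix_inv (E_matrix c k x) ** jost_solution q c k x) \<longlongrightarrow> S) at_bot) \<and>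
    scattering_a q c k =
      (Gamma (1/2 - \<i> * of_real \<mu> / of_real A))^2 /
      (Gamma (1/2 - g - \<i> * of_real \<mu> / of_real A) *
       Gamma (1/2 + g - \<i> * of_real \<mu> / of_real A)) \<and>
    scattering_b q c k = - sin (of_real pi * g) * (1 / of_real (cosh (pi * \<mu> / A))) \<and>
    (c = \<i> \<longrightarrow>
      scattering_b q c k = 0 \<and>
      (let \<mu>1 = \<i> * of_real A / 2 in
        scattering_a q c k = (of_real \<mu> - \<mu>1) / (of_real \<mu> - cnj \<mu>1)))"
proof -
  have "A > 0"
  proof -
    have "1 / Z < 1" using \<open>Z > 1\<close> by simp
    then show ?thesis unfolding \<open>A = Z - 1 / Z\<close> using \<open>Z > 1\<close> by linarith
  qed
  \<comment> \<open>g is real in the focusing case and imaginary in the defocusing one, so g^2 is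
    real and mu^2 = k^2 + g^2 holds in the complex numbers.\<close>
  have g: "g \<noteq> 0" and g2: "g\<^sup>2 = of_real (Re (g\<^sup>2))"
  proof -
    from assms(4) obtain s :: real where "s > 0" and "c = \<i> * of_real s \<or> c = of_real s"
      by auto
    then have "g = of_real s \<or> g = - \<i> * of_real s"
      unfolding \<open>c = \<i> * g\<close> by (auto simp: complex_eq_iff)
    with \<open>s > 0\<close> show "g \<noteq> 0" "g\<^sup>2 = of_real (Re (g\<^sup>2))"
      by (auto simp: power2_eq_square algebra_simps)
  qed
  have "\<mu> > 0" and mu2: "\<mu>\<^sup>2 = k\<^sup>2 + Re (g\<^sup>2)"
    using assms(6) unfolding assms(7) by simp_all
  have "g_of c = g" by (simp add: g_of_def \<open>c = \<i> * g\<close>)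
  interpret sech_potential A \<mu> k g c q
  proof
    show "complex_of_real (\<mu>\<^sup>2) = of_real (k\<^sup>2) + g\<^sup>2"
      unfolding mu2 by (subst g2) simp
    show "mu_of c k = \<mu>"
      by (simp add: mu_of_def \<open>g_of c = g\<close> assms(7))
  qed (fact \<open>A > 0\<close> g assms(5) assms(3) \<open>\<mu> > 0\<close>)+
  define \<gamma> :: complex where "\<gamma> = 1/2 - \<i> * of_real (\<mu> / A)"
  obtain s11 s21 where lim: "((\<lambda>x. matrix_inv (E_matrix c k x) ** jost_solution q c k x) \<longlongrightarrow>
      mat2 s11 (- sin (of_real pi * g) / of_real (cosh (pi * \<mu> / A))) s21
        ((Gamma \<gamma>)\<^sup>2 / (Gamma (\<gamma> - g) * Gamma (\<gamma> + g)))) at_bot"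
    using scattering_limit unfolding \<gamma>_def by blast
  have S: "scattering_matrix q c k = mat2 s11 (- sin (of_real pi * g) / of_real (cosh (pi * \<mu> / A))) s21
        ((Gamma \<gamma>)\<^sup>2 / (Gamma (\<gamma> - g) * Gamma (\<gamma> + g)))"
    unfolding scattering_matrix_def using lim by (intro tendsto_Lim) simp_all
  have a: "scattering_a q c k = (Gamma \<gamma>)\<^sup>2 / (Gamma (\<gamma> - g) * Gamma (\<gamma> + g))"
    and b: "scattering_b q c k = - sin (of_real pi * g) / of_real (cosh (pi * \<mu> / A))"
    by (simp_all add: scattering_a_def scattering_b_def S)
  have \<gamma>: "1/2 - \<i> * of_real \<mu> / of_real A = \<gamma>" "1/2 - g - \<i> * of_real \<mu> / of_real A = \<gamma> - g"
    "1/2 + g - \<i> * of_real \<mu> / of_real A = \<gamma> + g"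
    by (simp_all add: \<gamma>_def)
  have one_soliton: "scattering_b q c k = 0 \<and> scattering_a q c k =
      (of_real \<mu> - \<i> * of_real A / 2) / (of_real \<mu> - cnj (\<i> * of_real A / 2))" if "c = \<i>"
  proof -
    have "g = 1" using that \<open>c = \<i> * g\<close> by simp
    \<comment> \<open>\<open>\<gamma> - 1\<close> has real part -1/2, so its distance from the poles
      is read off the imaginary part - mu / A.\<close>
    have "Im (\<gamma> - 1) \<noteq> 0" using \<open>\<mu> > 0\<close> \<open>A > 0\<close> by (simp add: \<gamma>_def)
    then have nz: "\<gamma> - 1 \<notin> \<int>\<^sub>\<le>\<^sub>0" by (auto elim!: nonpos_Ints_cases simp: complex_eq_iff)
    have nz': "\<gamma> \<notin> \<int>\<^sub>\<le>\<^sub>0"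
      by (rule not_nonpos_Ints_Re_pos) (simp add: \<gamma>_def)
    then have "\<gamma> \<noteq> 0" by auto
    have "Gamma (\<gamma> + 1) = \<gamma> * Gamma \<gamma>" "Gamma \<gamma> = (\<gamma> - 1) * Gamma (\<gamma> - 1)"
      using Gamma_plus1[OF nz'] Gamma_plus1[OF nz] by simp_all
    then have "scattering_a q c k = (\<gamma> - 1) / \<gamma>"
      using Gamma_nonzero[OF nz] Gamma_nonzero[OF nz'] \<open>\<gamma> \<noteq> 0\<close>
      unfolding a \<open>g = 1\<close> by (simp add: power2_eq_square)
    \<comment> \<open>Numerator and denominator are scaled by i A, as i A gamma = mu + i A /
      2.\<close>
    also have "\<dots> = (of_real \<mu> - \<i> * of_real A / 2) / (of_real \<mu> + \<i> * of_real A / 2)"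
    proof -
      have "of_real \<mu> + \<i> * of_real A / 2 \<noteq> 0"
        using \<open>A > 0\<close> by (simp add: complex_eq_iff)
      moreover have "(\<gamma> - 1) * (of_real \<mu> + \<i> * of_real A / 2) = (of_real \<mu> - \<i> * of_real A / 2) * \<gamma>"
        using \<open>A > 0\<close> by (simp add: \<gamma>_def complex_eq_iff field_simps)
      ultimately show ?thesis
        using \<open>\<gamma> \<noteq> 0\<close> by (simp add: frac_eq_eq)
    qed
    finally show ?thesis
      unfolding b \<open>g = 1\<close> by simp
  qed
  show ?thesis
    unfolding \<gamma> Let_def using ex1_jost lim a b one_soliton by auto
qed

end
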